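(* Let $m,n$ be positive integers and let $\mathcal I=\{1,\dots,m+n\}$. Let $\Delta$ be the coproduct of the quantum superalgebra $U_q[gl(m|n)]$, and for $a,b\in\mathcal I$ put $S^a_b=\mathrm{sign}(a-b)$ (so $S^a_a=0$) and $\Delta_c=q_c-q_c^{-1}$. Then for any $a,b\in\mathcal I$ (including $a=b$), $$\Delta({E^a}_b)={E^a}_b\otimes K_a^{\frac12S^a_b}\overline K_b^{\,\frac12S^a_b}+\overline K_a^{\,\frac12S^a_b}K_b^{\frac12S^a_b}\otimes{E^a}_b-S^a_b\sum_c\Delta_c\left(\overline K_c^{\,\frac12S^a_b}K_b^{\frac12S^a_b}{E^a}_c\otimes{E^c}_bK_a^{\frac12S^a_b}\overline K_c^{\,\frac12S^a_b}\right),$$ where the sum ranges over all indices $c$ strictly between $a$ and $b$, and is ignored (equal to $0$) if $|a-b|\le1$.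
   Context: Grading on indices: $[a]=0$ if $a\le m$ and $[a]=1$ if $a>m$, for $a\in\mathcal I$. The parameter $q$ is a nonzero complex variable (generic, in particular $q^2\neq 1$), with roots/powers $q^N$ fixed consistently. Write $q_a:=q^{(-1)^{[a]}}$, $\overline q_a:=q_a^{-1}$, $\overline q:=q^{-1}$, $\overline K_a:=K_a^{-1}$ (so $\overline K_a^{\,N}=K_a^{-N}$). $\delta^a_b$ is the Kronecker delta. The scalar $\Delta_c$ (with subscript) is not to be confused with the coproduct $\Delta(\cdot)$. $U_q[gl(m|n)]$ is the unital associative $\mathbb Z_2$-graded algebra over $\mathbb C$ generated by the Cartan elements $K_a^N$ ($a\in\mathcal I$) and the simple lowering and raising generators ${E^{a+1}}_a$, ${E^a}_{a+1}$ ($1\le a<m+n$). Powers $N$ of $K_a$ are allowed to be non-integral (typically $N\in\frac12\mathbb Z$), with $K_a^0=\mathrm{Id}$ and $K_a^MK_a^N=K_a^{M+N}$; formally $K_a=q_a^{{E^a}_a}$, so $K_a^N=q_a^{N{E^a}_a}$. The grading is $[K_a^N]=0$, $[{E^a}_b]=[a]+[b]\pmod 2$, and $[X,Y]=XY-(-1)^{[X][Y]}YX$ is the graded commutator of homogeneous elements. The relations are: (1) $K_a^MK_b^N=K_b^NK_a^M$. (2) $K_a\,{E^b}_{b\pm1}\,\overline K_a=q_a^{\delta^a_b-\delta^a_{b\pm1}}{E^b}_{b\pm1}$. In accordance with $K_a^N=q_a^{N{E^a}_a}$, this is understood to hold also with $q$ replaced by $q^N$, i.e. $K_a^N\,{E^b}_{b\pm1}=q_a^{N(\delta^a_b-\delta^a_{b\pm1})}{E^b}_{b\pm1}K_a^N$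 for simple generators. (3) $[{E^a}_{a+1},{E^{b+1}}_b]=\delta^a_b\,\dfrac{K_a\overline K_{a+1}-\overline K_aK_{a+1}}{q_a-\overline q_a}$; and for $|a-b|>1$, ${E^{a+1}}_a{E^{b+1}}_b={E^{b+1}}_b{E^{a+1}}_a$ and ${E^a}_{a+1}{E^b}_{b+1}={E^b}_{b+1}{E^a}_{a+1}$. (4) $({E^m}_{m+1})^2=({E^{m+1}}_m)^2=0$. (5) Serre relations (whenever the indices make sense): for $a\ne m$, and with $(X,Y)$ equal to $({E^{a+1}}_a,{E^{a\pm1+1}}_{a\pm1})$ or $({E^a}_{a+1},{E^{a\pm1}}_{a\pm1+1})$, $X^2Y-(q+\overline q)XYX+YX^2=0$; and $[{E^{m+1}}_m,{E^{m+2}}_{m-1}]=[{E^m}_{m+1},{E^{m-1}}_{m+2}]=0$ (anticommutators, with the nonsimple generators defined below). The nonsimple generators are defined recursively, for $a<b$ with $b-a>1$ and any index $c$ with $a<c<b$ (no sum; the result does not depend on $c$), by $${E^b}_a={E^b}_c{E^c}_a-q_c\,{E^c}_a{E^b}_c\ \text{(lowering)},\qquad {E^a}_b={E^a}_c{E^c}_b-\overline q_c\,{E^c}_b{E^a}_c\ \text{(raising)}.$$ The coproduct $\Delta:U_q[gl(m|n)]\to U_q[gl(m|n)]\otimes U_q[gl(m|n)]$ is the $\mathbb Z_2$-graded algebra homomorphism ($\Delta(XY)=\Delta(X)\Delta(Y)$), where the tensor product carries the graded multiplication $(X\otimes Y)(X'\otimes Y')=(-1)^{[Y][X']}XX'\otimes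 YY'$ for homogeneous elements, determined by $$\Delta({E^{a+1}}_a)={E^{a+1}}_a\otimes\overline K_a^{\frac12}K_{a+1}^{\frac12}+K_a^{\frac12}\overline K_{a+1}^{\frac12}\otimes{E^{a+1}}_a,$$ $$\Delta({E^a}_{a+1})={E^a}_{a+1}\otimes\overline K_a^{\frac12}K_{a+1}^{\frac12}+K_a^{\frac12}\overline K_{a+1}^{\frac12}\otimes{E^a}_{a+1},$$ $$\Delta(K_a^N)=K_a^N\otimes K_a^N.$$ Convention for $a=b$: ${E^a}_a$ is identified through $K_a=q^{(-1)^{[a]}{E^a}_a}$, so the claim for $a=b$, namely $\Delta({E^a}_a)={E^a}_a\otimes\mathrm{Id}+\mathrm{Id}\otimes{E^a}_a$, is understood as equivalent to $\Delta(K_a)=K_a\otimes K_a$. *)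

theory Defs
  imports
    Complex_Main
    "HOL-Algebra.QuotRing"
    "HOL-Algebra.Module"
    "HOL-Library.Poly_Mapping"
    "HOL-Library.Z2"
begin

section \<open>Complex superalgebras\<close>

text \<open>
  A complex superalgebra is a (not necessarily commutative) ring with a scalar multiplication by
  complex numbers and with homogeneous parts of degree \<open>0\<close> and \<open>1\<close> in \<open>\<int>/2\<int>\<close> (type \<^typ>\<open>bit\<close>).
\<close>

record 'a superalg = "(complex, 'a) module" +
  homog :: "bit \<Rightarrow> 'a set"

text \<open>The sign \<open>(-1)\<^sup>d\<^sup>e\<close> for parities \<open>d\<close> and \<open>e\<close>.\<close>

definition koszul :: "bit \<Rightarrow> bit \<Rightarrow> complex"
  where "koszul d e = (if d = 1 \<and> e = 1 then - 1 else 1)"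

definition superalg_hom :: "'a superalg \<Rightarrow> 'b superalg \<Rightarrow> ('a \<Rightarrow> 'b) set"
  where "superalg_hom A B =
    {f \<in> ring_hom A B.
       (\<forall>c. \<forall>x\<in>carrier A. f (c \<odot>\<^bsub>A\<^esub> x) = c \<odot>\<^bsub>B\<^esub> f x) \<and>
       (\<forall>d. f ` homog A d \<subseteq> homog B d)}"

text \<open>
  Quotient by \<open>I\<close>, with all operations induced on cosets. It is used below also for a linear
  subspace \<open>I\<close> of a structure whose multiplication becomes associative only modulo \<open>I\<close>.
\<close>

definition quot_superalg :: "'a superalg \<Rightarrow> 'a set \<Rightarrow> 'a set superalg"
  where "quot_superalg A I =
    \<lparr>carrier = carrier (A Quot I), mult = mult (A Quot I), one = one (A Quot I),
     zero = zero (A Quot I), add = add (A Quot I),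
     smult = (\<lambda>c X. \<Union>x\<in>X. I +>\<^bsub>A\<^esub> (c \<odot>\<^bsub>A\<^esub> x)),
     homog = (\<lambda>d. (\<lambda>x. I +>\<^bsub>A\<^esub> x) ` homog A d)\<rparr>"


section \<open>Free superalgebras\<close>

text \<open>
  With concatenation as addition on lists, \<^typ>\<open>'g list \<Rightarrow>\<^sub>0 complex\<close> with its convolution
  product is the free associative algebra on \<^typ>\<open>'g\<close>.
\<close>

instantiation list :: (type) monoid_add
begin

definition zero_list :: "'a list" where "zero_list = []"
definition plus_list :: "'a list \<Rightarrow> 'a list \<Rightarrow> 'a list" where "plus_list = (@)"

instance by standard (simp_all add: zero_list_def plus_list_def)

end

definition scale :: "complex \<Rightarrow> ('a \<Rightarrow>\<^sub>0 complex) \<Rightarrow> 'a \<Rightarrow>\<^sub>0 complex"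
  where "scale c = Poly_Mapping.map ((*) c)"

definition free_superalg :: "'g set \<Rightarrow> ('g \<Rightarrow> bit) \<Rightarrow> ('g list \<Rightarrow>\<^sub>0 complex) superalg"
  where "free_superalg G par =
    \<lparr>carrier = {f. Poly_Mapping.keys f \<subseteq> lists G}, mult = (*), one = 1, zero = 0, add = (+),
     smult = scale,
     homog = (\<lambda>d. {f. Poly_Mapping.keys f \<subseteq> {w \<in> lists G. sum_list (map par w) = d}})\<rparr>"

definition fgen :: "'g \<Rightarrow> 'g list \<Rightarrow>\<^sub>0 complex"
  where "fgen g = Poly_Mapping.single [g] 1"


section \<open>Graded tensor products\<close>

definition homog_comp :: "'a superalg \<Rightarrow> bit \<Rightarrow> 'a \<Rightarrow> 'a"
  where "homog_comp A d x = (THE y. y \<in> homog A d \<and> x \<ominus>\<^bsub>A\<^esub> y \<in> homog A (d + 1))"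

text \<open>
  The free vector space on \<open>A \<times> B\<close>, with the bilinear extension of
  \<open>(x, y) (x', y') = \<Sum>\<^sub>i\<^sub>,\<^sub>j (-1)\<^sup>i\<^sup>j (x x'\<^sub>j, y\<^sub>i y')\<close> where \<open>x'\<^sub>j\<close> and \<open>y\<^sub>i\<close> are homogeneous components.
  For homogeneous \<open>y\<close>, \<open>x'\<close> this is the graded rule, modulo the bilinearity relations.
\<close>

definition pretensor :: "'a superalg \<Rightarrow> 'b superalg \<Rightarrow> ('a \<times> 'b \<Rightarrow>\<^sub>0 complex) superalg"
  where "pretensor A B =
    \<lparr>carrier = {v. Poly_Mapping.keys v \<subseteq> carrier A \<times> carrier B},
     mult = (\<lambda>v w. \<Sum>(x, y)\<in>Poly_Mapping.keys v. \<Sum>(x', y')\<in>Poly_Mapping.keys w. \<Sum>i\<in>{0, 1}. \<Sum>j\<in>{0, 1}.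
        Poly_Mapping.single (x \<otimes>\<^bsub>A\<^esub> homog_comp A j x', homog_comp B i y \<otimes>\<^bsub>B\<^esub> y')
          (koszul i j * Poly_Mapping.lookup v (x, y) * Poly_Mapping.lookup w (x', y'))),
     one = Poly_Mapping.single (\<one>\<^bsub>A\<^esub>, \<one>\<^bsub>B\<^esub>) 1, zero = 0, add = (+), smult = scale,
     homog = (\<lambda>d. {v. Poly_Mapping.keys v \<subseteq> {(x, y). \<exists>i j. i + j = d \<and> x \<in> homog A i \<and> y \<in> homog B j}})\<rparr>"

definition bilinear_relators :: "'a superalg \<Rightarrow> 'b superalg \<Rightarrow> ('a \<times> 'b \<Rightarrow>\<^sub>0 complex) set"
  where "bilinear_relators A B =
    (let s = (\<lambda>x y. Poly_Mapping.single (x, y) (1 :: complex)) in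
     {s (x \<oplus>\<^bsub>A\<^esub> x') y - s x y - s x' y | x x' y. x \<in> carrier A \<and> x' \<in> carrier A \<and> y \<in> carrier B} \<union>
     {s x (y \<oplus>\<^bsub>B\<^esub> y') - s x y - s x y' | x y y'. x \<in> carrier A \<and> y \<in> carrier B \<and> y' \<in> carrier B} \<union>
     {s (c \<odot>\<^bsub>A\<^esub> x) y - scale c (s x y) | c x y. x \<in> carrier A \<and> y \<in> carrier B} \<union>
     {s x (c \<odot>\<^bsub>B\<^esub> y) - scale c (s x y) | c x y. x \<in> carrier A \<and> y \<in> carrier B})"

definition tensor_null :: "'a superalg \<Rightarrow> 'b superalg \<Rightarrow> ('a \<times> 'b \<Rightarrow>\<^sub>0 complex) set"
  where "tensor_null A B = Modules.module.span scale (bilinear_relators A B)"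

definition tensor_superalg ::
    "'a superalg \<Rightarrow> 'b superalg \<Rightarrow> ('a \<times> 'b \<Rightarrow>\<^sub>0 complex) set superalg"
  where "tensor_superalg A B = quot_superalg (pretensor A B) (tensor_null A B)"

definition tensor_elt ::
    "'a superalg \<Rightarrow> 'b superalg \<Rightarrow> 'a \<Rightarrow> 'b \<Rightarrow> ('a \<times> 'b \<Rightarrow>\<^sub>0 complex) set"
  where "tensor_elt A B x y = tensor_null A B +>\<^bsub>pretensor A B\<^esub> Poly_Mapping.single (x, y) 1"


section \<open>The quantum superalgebra \<open>U\<^sub>q[gl(m|n)]\<close>\<close>

text \<open>
  \<open>Cartan a N\<close> is \<open>K\<^sub>a\<^sup>N\<close>; \<open>Lower a\<close> is the simple generator with upper index \<open>a + 1\<close> and lower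
  index \<open>a\<close>; \<open>Raise a\<close> is the one with upper index \<open>a\<close> and lower index \<open>a + 1\<close>.
\<close>

datatype gen = Cartan nat real | Lower nat | Raise nat

text \<open>
  \<open>P\<close> is the group of admitted exponents \<open>N\<close> (for instance the half-integers), and \<open>qp N\<close> is
  the consistently fixed value of \<open>q\<^sup>N\<close>.
\<close>

definition q_powers :: "complex \<Rightarrow> real set \<Rightarrow> (real \<Rightarrow> complex) \<Rightarrow> bool"
  where "q_powers q P qp \<longleftrightarrow>
    1 / 2 \<in> P \<and> (\<forall>M\<in>P. \<forall>N\<in>P. M - N \<in> P) \<and>
    qp 1 = q \<and> (\<forall>M\<in>P. \<forall>N\<in>P. qp (M + N) = qp M * qp N)"

definition idx_parity :: "nat \<Rightarrow> nat \<Rightarrow> bit"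
  where "idx_parity m a = (if a \<le> m then 0 else 1)"

text \<open>\<open>qa m qp a N\<close> is \<open>q\<^sub>a\<^sup>N\<close> where \<open>q\<^sub>a = q\<close> for even \<open>a\<close> and \<open>q\<^sub>a = q\<^sup>-\<^sup>1\<close> for odd \<open>a\<close>.\<close>

definition qa :: "nat \<Rightarrow> (real \<Rightarrow> complex) \<Rightarrow> nat \<Rightarrow> real \<Rightarrow> complex"
  where "qa m qp a N = qp (if idx_parity m a = 0 then N else - N)"

fun gen_parity :: "nat \<Rightarrow> gen \<Rightarrow> bit"
  where
    "gen_parity m (Cartan a N) = 0"
  | "gen_parity m (Lower a) = idx_parity m (a + 1) + idx_parity m a"
  | "gen_parity m (Raise a) = idx_parity m a + idx_parity m (a + 1)"

definition gens :: "nat \<Rightarrow> nat \<Rightarrow> real set \<Rightarrow> gen set"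
  where "gens m n P =
    {Cartan a N | a N. a \<in> {1..m + n} \<and> N \<in> P} \<union> Lower ` {1..<m + n} \<union> Raise ` {1..<m + n}"

text \<open>
  Representatives in the free algebra of the generators with upper index \<open>a\<close> and lower index \<open>b\<close>,
  \<open>a \<noteq> b\<close>. In the recursion the intermediate index is the one adjacent to \<open>min a b\<close>; in the quotient
  every strictly intermediate index gives the same element (\<open>Uq_E_lower\<close>, \<open>Uq_E_raise\<close> below). The value for \<open>a = b\<close> is a dummy.
\<close>

function free_E :: "nat \<Rightarrow> (real \<Rightarrow> complex) \<Rightarrow> nat \<Rightarrow> nat \<Rightarrow> gen list \<Rightarrow>\<^sub>0 complex"
  where "free_E m qp a b =
    (if a = b then 0
     else if a = b + 1 then fgen (Lower b)
     else if b = a + 1 then fgen (Raise a)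
     else if b < a then
       (let c = b + 1 in
        free_E m qp a c * free_E m qp c b - scale (qa m qp c 1) (free_E m qp c b * free_E m qp a c))
     else
       (let c = a + 1 in
        free_E m qp a c * free_E m qp c b - scale (qa m qp c (- 1)) (free_E m qp c b * free_E m qp a c)))"
  by pat_completeness auto
termination
  by (relation "measure (\<lambda>(m, qp, a, b). (a - b) + (b - a))") auto

declare free_E.simps [simp del]

definition gcomm :: "bit \<Rightarrow> bit \<Rightarrow> (gen list \<Rightarrow>\<^sub>0 complex) \<Rightarrow> (gen list \<Rightarrow>\<^sub>0 complex) \<Rightarrow> gen list \<Rightarrow>\<^sub>0 complex"
  where "gcomm d e x y = x * y - scale (koszul d e) (y * x)"

definition kdelta :: "nat \<Rightarrow> nat \<Rightarrow> real"
  where "kdelta a b = (if a = b then 1 else 0)"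

text \<open>A relation \<open>x = y\<close> is represented by the element \<open>x - y\<close> of the free algebra.\<close>

definition Uq_relators :: "nat \<Rightarrow> nat \<Rightarrow> real set \<Rightarrow> (real \<Rightarrow> complex) \<Rightarrow> (gen list \<Rightarrow>\<^sub>0 complex) set"
  where "Uq_relators m n P qp =
   (let I = {1..m + n}; J = {1..<m + n};
        K = (\<lambda>a N. fgen (Cartan a N)); L = (\<lambda>a. fgen (Lower a)); R = (\<lambda>a. fgen (Raise a));
        serre = (\<lambda>x y. x * x * y - scale (qp 1 + qp (- 1)) (x * y * x) + y * x * x)
    in
    {K a 0 - 1 | a. a \<in> I} \<union>
    {K a M * K a N - K a (M + N) | a M N. a \<in> I \<and> M \<in> P \<and> N \<in> P} \<union>
    {K a M * K b N - K b N * K a M | a b M N. a \<in> I \<and> b \<in> I \<and> M \<in> P \<and> N \<in> P} \<union>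
    {K a N * R b - scale (qa m qp a (N * (kdelta a b - kdelta a (b + 1)))) (R b * K a N)
       | a b N. a \<in> I \<and> b \<in> J \<and> N \<in> P} \<union>
    {K a N * L b - scale (qa m qp a (N * (kdelta a (b + 1) - kdelta a b))) (L b * K a N)
       | a b N. a \<in> I \<and> b \<in> J \<and> N \<in> P} \<union>
    {gcomm (gen_parity m (Raise a)) (gen_parity m (Lower b)) (R a) (L b) -
       (if a = b
        then scale (1 / (qa m qp a 1 - qa m qp a (- 1)))
               (K a 1 * K (a + 1) (- 1) - K a (- 1) * K (a + 1) 1)
        else 0)
       | a b. a \<in> J \<and> b \<in> J} \<union>
    {L a * L b - L b * L a | a b. a \<in> J \<and> b \<in> J \<and> (a + 1 < b \<or> b + 1 < a)} \<union>
    {R a * R b - R b * R a | a b. a \<in> J \<and> b \<in> J \<and> (a + 1 < b \<or> b + 1 < a)} \<union>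
    {R m * R m, L m * L m} \<union>
    {serre (L a) (L b) | a b. a \<in> J \<and> b \<in> J \<and> a \<noteq> m \<and> (b = a + 1 \<or> a = b + 1)} \<union>
    {serre (R a) (R b) | a b. a \<in> J \<and> b \<in> J \<and> a \<noteq> m \<and> (b = a + 1 \<or> a = b + 1)} \<union>
    (if m \<ge> 2 \<and> n \<ge> 2
     then {gcomm 1 1 (L m) (free_E m qp (m + 2) (m - 1)), gcomm 1 1 (R m) (free_E m qp (m - 1) (m + 2))}
     else {}))"

definition Uq_free :: "nat \<Rightarrow> nat \<Rightarrow> real set \<Rightarrow> (gen list \<Rightarrow>\<^sub>0 complex) superalg"
  where "Uq_free m n P = free_superalg (gens m n P) (gen_parity m)"

definition Uq_ideal :: "nat \<Rightarrow> nat \<Rightarrow> real set \<Rightarrow> (real \<Rightarrow> complex) \<Rightarrow> (gen list \<Rightarrow>\<^sub>0 complex) set"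
  where "Uq_ideal m n P qp = Idl\<^bsub>Uq_free m n P\<^esub> (Uq_relators m n P qp)"

definition Uq :: "nat \<Rightarrow> nat \<Rightarrow> real set \<Rightarrow> (real \<Rightarrow> complex) \<Rightarrow> (gen list \<Rightarrow>\<^sub>0 complex) set superalg"
  where "Uq m n P qp = quot_superalg (Uq_free m n P) (Uq_ideal m n P qp)"

definition Uq_K ::
    "nat \<Rightarrow> nat \<Rightarrow> real set \<Rightarrow> (real \<Rightarrow> complex) \<Rightarrow> nat \<Rightarrow> real \<Rightarrow> (gen list \<Rightarrow>\<^sub>0 complex) set"
  where "Uq_K m n P qp a N = Uq_ideal m n P qp +>\<^bsub>Uq_free m n P\<^esub> fgen (Cartan a N)"

text \<open>\<open>Uq_E m n P qp a b\<close> has upper index \<open>a\<close> and lower index \<open>b\<close>.\<close>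

definition Uq_E ::
    "nat \<Rightarrow> nat \<Rightarrow> real set \<Rightarrow> (real \<Rightarrow> complex) \<Rightarrow> nat \<Rightarrow> nat \<Rightarrow> (gen list \<Rightarrow>\<^sub>0 complex) set"
  where "Uq_E m n P qp a b = Uq_ideal m n P qp +>\<^bsub>Uq_free m n P\<^esub> free_E m qp a b"

definition is_coproduct ::
    "nat \<Rightarrow> nat \<Rightarrow> real set \<Rightarrow> (real \<Rightarrow> complex) \<Rightarrow>
     ((gen list \<Rightarrow>\<^sub>0 complex) set \<Rightarrow>
      ((gen list \<Rightarrow>\<^sub>0 complex) set \<times> (gen list \<Rightarrow>\<^sub>0 complex) set \<Rightarrow>\<^sub>0 complex) set) \<Rightarrow> bool"
  where "is_coproduct m n P qp \<Delta> \<longleftrightarrow>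
   (let U = Uq m n P qp; T = tensor_superalg U U; t = tensor_elt U U;
        K = Uq_K m n P qp; E = Uq_E m n P qp
    in
    \<Delta> \<in> superalg_hom U T \<and>
    (\<forall>a\<in>{1..m + n}. \<forall>N\<in>P. \<Delta> (K a N) = t (K a N) (K a N)) \<and>
    (\<forall>a\<in>{1..<m + n}.
       \<Delta> (E (a + 1) a) =
         t (E (a + 1) a) (K a (- 1 / 2) \<otimes>\<^bsub>U\<^esub> K (a + 1) (1 / 2)) \<oplus>\<^bsub>T\<^esub>
         t (K a (1 / 2) \<otimes>\<^bsub>U\<^esub> K (a + 1) (- 1 / 2)) (E (a + 1) a) \<and>
       \<Delta> (E a (a + 1)) =
         t (E a (a + 1)) (K a (- 1 / 2) \<otimes>\<^bsub>U\<^esub> K (a + 1) (1 / 2)) \<oplus>\<^bsub>T\<^esub>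
         t (K a (1 / 2) \<otimes>\<^bsub>U\<^esub> K (a + 1) (- 1 / 2)) (E a (a + 1))))"


section \<open>The defining recursion holds for every intermediate index\<close>

lemma scale_lookup [simp]: "Poly_Mapping.lookup (scale c x) k = c * Poly_Mapping.lookup x k"
  by (simp add: scale_def Poly_Mapping.map.rep_eq when_def)

lemma keys_scale: "Poly_Mapping.keys (scale c x) \<subseteq> Poly_Mapping.keys x"
  by (auto simp: in_keys_iff)

lemma keys_uminus: "Poly_Mapping.keys (- x :: 'a \<Rightarrow>\<^sub>0 complex) = Poly_Mapping.keys x"
  by (auto simp: in_keys_iff)

lemma keys_minus_subset:
  "Poly_Mapping.keys (x - y :: 'a \<Rightarrow>\<^sub>0 complex) \<subseteq> Poly_Mapping.keys x \<union> Poly_Mapping.keys y"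
  by (auto simp: in_keys_iff lookup_minus)

lemma keys_mult_lists:
  fixes f g :: "'g list \<Rightarrow>\<^sub>0 complex"
  assumes "Poly_Mapping.keys f \<subseteq> lists G" "Poly_Mapping.keys g \<subseteq> lists G"
  shows "Poly_Mapping.keys (f * g) \<subseteq> lists G"
  using keys_mult[of f g] assms by (fastforce simp: plus_list_def)

lemma free_ring: "ring (free_superalg G par)"
proof (rule ringI)
  show "abelian_group (free_superalg G par)"
  proof (rule abelian_groupI, goal_cases)
    case (6 x)
    then show ?case
      by (intro bexI[of _ "- x"]) (auto simp: free_superalg_def keys_uminus)
  qed (auto simp: free_superalg_def algebra_simps dest: set_mp[OF keys_add])
  show "Group.monoid (free_superalg G par)"
    by (rule monoidI)
      (auto simp: free_superalg_def algebra_simps zero_list_def dest: set_mp[OF keys_mult_lists, rotated 2])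
qed (auto simp: free_superalg_def algebra_simps)

lemma qpow_closed:
  assumes "q_powers q P qp"
  shows "0 \<in> P" "1/2 \<in> P" "-1/2 \<in> P" "1 \<in> P" "-1 \<in> P"
   "M \<in> P \<Longrightarrow> - M \<in> P" "M \<in> P \<Longrightarrow> N \<in> P \<Longrightarrow> M + N \<in> P"
proof -
  have h: "1/2 \<in> P" and d: "\<And>M N. M \<in> P \<Longrightarrow> N \<in> P \<Longrightarrow> M - N \<in> P"
    using assms by (auto simp: q_powers_def)
  show z: "0 \<in> P" using d[OF h h] by simp
  show m: "M \<in> P \<Longrightarrow> - M \<in> P" for M using d[OF z, of M] by simp
  show p: "M \<in> P \<Longrightarrow> N \<in> P \<Longrightarrow> M + N \<in> P" for M N using d[OF _ m, of M N] by simp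
  show "1/2 \<in> P" by fact
  show "-1/2 \<in> P" using m[OF h] by simp
  show "1 \<in> P" using p[OF h h] by simp
  then show "-1 \<in> P" by (rule m)
qed

context
  fixes m n :: nat and P :: "real set" and q :: complex and qp :: "real \<Rightarrow> complex"
  assumes mn: "0 < m" "0 < n" and qp: "q_powers q P qp"
begin

lemma Uq_free_ring: "ring (Uq_free m n P)" unfolding Uq_free_def by (rule free_ring)

lemma Uq_free_simps:
  "x \<otimes>\<^bsub>Uq_free m n P\<^esub> y = x * y" "x \<oplus>\<^bsub>Uq_free m n P\<^esub> y = x + y" "\<zero>\<^bsub>Uq_free m n P\<^esub> = 0" "\<one>\<^bsub>Uq_free m n P\<^esub> = 1" "c \<odot>\<^bsub>Uq_free m n P\<^esub> x = scale c x"
  by (auto simp: Uq_free_def free_superalg_def)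

lemma Uq_free_closed:
  "0 \<in> carrier (Uq_free m n P)" "1 \<in> carrier (Uq_free m n P)"
  "x \<in> carrier (Uq_free m n P) \<Longrightarrow> y \<in> carrier (Uq_free m n P) \<Longrightarrow> x + y \<in> carrier (Uq_free m n P)"
  "x \<in> carrier (Uq_free m n P) \<Longrightarrow> y \<in> carrier (Uq_free m n P) \<Longrightarrow> x - y \<in> carrier (Uq_free m n P)"
  "x \<in> carrier (Uq_free m n P) \<Longrightarrow> y \<in> carrier (Uq_free m n P) \<Longrightarrow> x * y \<in> carrier (Uq_free m n P)"
  "x \<in> carrier (Uq_free m n P) \<Longrightarrow> scale c x \<in> carrier (Uq_free m n P)"
  "g \<in> gens m n P \<Longrightarrow> fgen g \<in> carrier (Uq_free m n P)"
  by (auto simp: Uq_free_def free_superalg_def fgen_def zero_list_def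
    dest: set_mp[OF keys_add] set_mp[OF keys_minus_subset] set_mp[OF keys_scale]
      set_mp[OF keys_mult_lists, rotated 2])

lemma if_memI: "(c \<Longrightarrow> x \<in> S) \<Longrightarrow> (\<not> c \<Longrightarrow> y \<in> S) \<Longrightarrow> (if c then x else y) \<in> S"
  by simp

lemma free_E_closed:
  "a \<in> {1..m+n} \<Longrightarrow> b \<in> {1..m+n} \<Longrightarrow> free_E m qp a b \<in> carrier (Uq_free m n P)"
proof (induction "(a - b) + (b - a)" arbitrary: a b rule: less_induct)
  case less
  have *: "free_E m qp a' b' \<in> carrier (Uq_free m n P)"
    if "(a' - b') + (b' - a') < (a - b) + (b - a)" "a' \<in> {1..m+n}" "b' \<in> {1..m+n}" for a' b'
    using less.hyps that by blast
  show ?case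
    unfolding free_E.simps[of m qp a b] Let_def
    by (intro if_memI Uq_free_closed *; use less.prems in \<open>simp add: gens_def image_iff\<close>; linarith?)
qed

lemma Uq_relators_closed: "Uq_relators m n P qp \<subseteq> carrier (Uq_free m n P)"
proof -
  note q = qpow_closed[OF qp]
  have K: "fgen (Cartan a N) \<in> carrier (Uq_free m n P)" if "a \<in> {1..m+n}" "N \<in> P" for a N
    by (rule Uq_free_closed) (use that in \<open>auto simp: gens_def\<close>)
  have L: "fgen (Lower a) \<in> carrier (Uq_free m n P)" "fgen (Raise a) \<in> carrier (Uq_free m n P)" if "a \<in> {1..<m+n}" for a
    by (rule Uq_free_closed; use that in \<open>auto simp: gens_def\<close>)+
  have J: "a \<in> {1..m+n}" "a + 1 \<in> {1..m+n}" if "a \<in> {1..<m+n}" for a using that by auto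
  have M: "m \<in> {1..<m+n}" using mn by auto
  show ?thesis
    unfolding Uq_relators_def Let_def gcomm_def
    apply (intro Un_least subsetI)
    subgoal by (elim CollectE exE conjE; hypsubst; intro Uq_free_closed(1-6) K L q; assumption)
    subgoal by (elim CollectE exE conjE; hypsubst; intro Uq_free_closed(1-6) K L q; assumption)
    subgoal by (elim CollectE exE conjE; hypsubst; intro Uq_free_closed(1-6) K L q; assumption)
    subgoal by (elim CollectE exE conjE; hypsubst; intro Uq_free_closed(1-6) K L q; assumption)
    subgoal by (elim CollectE exE conjE; hypsubst; intro Uq_free_closed(1-6) K L q; assumption)
    subgoal by (elim CollectE exE conjE; hypsubst; intro if_memI Uq_free_closed(1-6) K L q; (rule J)?; assumption)
    subgoal by (elim CollectE exE conjE; hypsubst; intro Uq_free_closed(1-6) L; assumption)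
    subgoal by (elim CollectE exE conjE; hypsubst; intro Uq_free_closed(1-6) L; assumption)
    subgoal by (elim insertE emptyE; hypsubst; intro Uq_free_closed(1-6) L M)
    subgoal by (elim CollectE exE conjE; hypsubst; intro Uq_free_closed(1-6) L; assumption)
    subgoal by (elim CollectE exE conjE; hypsubst; intro Uq_free_closed(1-6) L; assumption)
    subgoal
      apply (split if_split_asm)
      subgoal by (elim insertE emptyE; hypsubst; intro Uq_free_closed(1-6) L M free_E_closed; auto)
      subgoal by simp
      done
    done
qed

lemma Uq_ideal_ideal: "ideal (Uq_ideal m n P qp) (Uq_free m n P)"
  unfolding Uq_ideal_def by (rule ring.genideal_ideal[OF Uq_free_ring Uq_relators_closed])

lemma Uq_relators_ideal: "x \<in> Uq_relators m n P qp \<Longrightarrow> x \<in> Uq_ideal m n P qp"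
  using ring.genideal_self[OF Uq_free_ring Uq_relators_closed] by (auto simp: Uq_ideal_def)

lemma Uq_ideal_closed:
  "0 \<in> Uq_ideal m n P qp" "x \<in> Uq_ideal m n P qp \<Longrightarrow> y \<in> Uq_ideal m n P qp \<Longrightarrow> x + y \<in> Uq_ideal m n P qp" "x \<in> Uq_ideal m n P qp \<Longrightarrow> x \<in> carrier (Uq_free m n P)"
  "x \<in> Uq_ideal m n P qp \<Longrightarrow> y \<in> carrier (Uq_free m n P) \<Longrightarrow> x * y \<in> Uq_ideal m n P qp" "x \<in> Uq_ideal m n P qp \<Longrightarrow> y \<in> carrier (Uq_free m n P) \<Longrightarrow> y * x \<in> Uq_ideal m n P qp"
  "x \<in> Uq_ideal m n P qp \<Longrightarrow> scale c x \<in> Uq_ideal m n P qp" "x \<in> Uq_ideal m n P qp \<Longrightarrow> - x \<in> Uq_ideal m n P qp" "x \<in> Uq_ideal m n P qp \<Longrightarrow> y \<in> Uq_ideal m n P qp \<Longrightarrow> x - y \<in> Uq_ideal m n P qp"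
proof -
  interpret ideal "Uq_ideal m n P qp" "Uq_free m n P" by (rule Uq_ideal_ideal)
  show "0 \<in> Uq_ideal m n P qp" using zero_closed additive_subgroup.zero_closed[OF is_additive_subgroup] by (simp add: Uq_free_simps)
  show A: "x \<in> Uq_ideal m n P qp \<Longrightarrow> y \<in> Uq_ideal m n P qp \<Longrightarrow> x + y \<in> Uq_ideal m n P qp" for x y using additive_subgroup.a_closed[OF is_additive_subgroup, of x y] by (simp add: Uq_free_simps)
  show B: "x \<in> Uq_ideal m n P qp \<Longrightarrow> x \<in> carrier (Uq_free m n P)" for x by (rule Icarr)
  show "x \<in> Uq_ideal m n P qp \<Longrightarrow> y \<in> carrier (Uq_free m n P) \<Longrightarrow> x * y \<in> Uq_ideal m n P qp" for x y using I_r_closed[of x y] by (simp add: Uq_free_simps)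
  show L: "x \<in> Uq_ideal m n P qp \<Longrightarrow> y \<in> carrier (Uq_free m n P) \<Longrightarrow> y * x \<in> Uq_ideal m n P qp" for x y using I_l_closed[of x y] by (simp add: Uq_free_simps)
  have s: "scale c x = Poly_Mapping.single 0 c * x" for c and x :: "gen list \<Rightarrow>\<^sub>0 complex"
    by (simp add: scale_def mult_map_scale_conv_mult)
  have "Poly_Mapping.single 0 c \<in> carrier (Uq_free m n P)" for c
    by (auto simp: Uq_free_def free_superalg_def zero_list_def)
  then show S: "x \<in> Uq_ideal m n P qp \<Longrightarrow> scale c x \<in> Uq_ideal m n P qp" for c x by (auto simp: s intro: L)
  have "- x = scale (-1) x" for x :: "gen list \<Rightarrow>\<^sub>0 complex"
    by (rule poly_mapping_eqI) simp
  then show M: "x \<in> Uq_ideal m n P qp \<Longrightarrow> - x \<in> Uq_ideal m n P qp" for x by (auto intro: S)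
  show "x \<in> Uq_ideal m n P qp \<Longrightarrow> y \<in> Uq_ideal m n P qp \<Longrightarrow> x - y \<in> Uq_ideal m n P qp" for x y using A[OF _ M, of x y] by simp
qed

lemma scale_alg:
  fixes x y :: "gen list \<Rightarrow>\<^sub>0 complex"
  shows "scale c x * y = scale c (x * y)" "x * scale c y = scale c (x * y)"
    "scale c (x + y) = scale c x + scale c y" "scale c (x - y) = scale c x - scale c y"
    "scale c (scale d x) = scale (c * d) x" "scale c (- x) = - scale c x"
proof -
  have s: "scale c x = Poly_Mapping.single 0 c * x" for c and x :: "gen list \<Rightarrow>\<^sub>0 complex"
    by (simp add: scale_def mult_map_scale_conv_mult)
  show "scale c x * y = scale c (x * y)" by (simp add: s mult.assoc)
  have e: "y = (\<Sum>k\<in>Poly_Mapping.keys y. Poly_Mapping.single k (Poly_Mapping.lookup y k))"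
    for y :: "gen list \<Rightarrow>\<^sub>0 complex"
    by (rule poly_mapping_eqI) (auto simp: lookup_sum lookup_single when_def sum.delta in_keys_iff)
  have "y * Poly_Mapping.single 0 c = Poly_Mapping.single 0 c * y" for y :: "gen list \<Rightarrow>\<^sub>0 complex"
    by (subst (1 2) e) (simp add: sum_distrib_left sum_distrib_right mult_single mult.commute)
  then show "x * scale c y = scale c (x * y)" unfolding s by (metis mult.assoc)
  show "scale c (x + y) = scale c x + scale c y" "scale c (x - y) = scale c x - scale c y"
    by (simp_all add: s distrib_left right_diff_distrib)
  show "scale c (scale d x) = scale (c * d) x"
    by (simp add: s mult_single mult.assoc[symmetric])
  show "scale c (- x) = - scale c x"
    by (simp add: s)
qed

lemma comm_mult:
  assumes "x * z - z * x \<in> Uq_ideal m n P qp" "y * z - z * y \<in> Uq_ideal m n P qp" "x \<in> carrier (Uq_free m n P)" "y \<in> carrier (Uq_free m n P)"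
  shows "(x * y) * z - z * (x * y) \<in> Uq_ideal m n P qp"
proof -
  have "(x * y) * z - z * (x * y) = x * (y * z - z * y) + (x * z - z * x) * y"
    by (simp add: algebra_simps)
  then show ?thesis using assms by (auto intro: Uq_ideal_closed(2,4-8))
qed

lemma comm_lin:
  assumes "x * z - z * x \<in> Uq_ideal m n P qp" "y * z - z * y \<in> Uq_ideal m n P qp"
  shows "(x - scale c y) * z - z * (x - scale c y) \<in> Uq_ideal m n P qp"
proof -
  have "(x - scale c y) * z - z * (x - scale c y) = (x * z - z * x) - scale c (y * z - z * y)"
    by (simp add: algebra_simps scale_alg)
  then show ?thesis using assms by (auto intro: Uq_ideal_closed(2,4-8))
qed

lemma Uq_relators_far:
  assumes "a \<in> {1..<m + n}" "b \<in> {1..<m + n}" "a + 1 < b \<or> b + 1 < a"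
  shows "fgen (Lower a) * fgen (Lower b) - fgen (Lower b) * fgen (Lower a) \<in> Uq_ideal m n P qp"
    "fgen (Raise a) * fgen (Raise b) - fgen (Raise b) * fgen (Raise a) \<in> Uq_ideal m n P qp"
  by (rule Uq_relators_ideal, unfold Uq_relators_def Let_def Un_iff, use assms in blast)+

lemma comm_lower:
  assumes "1 \<le> b" "b + 1 < c" "c < a" "a \<le> m + n"
  shows "free_E m qp a c * fgen (Lower b) - fgen (Lower b) * free_E m qp a c \<in> Uq_ideal m n P qp"
  using assms
proof (induction "a - c" arbitrary: c rule: less_induct)
  case less
  have base: "fgen (Lower c) * fgen (Lower b) - fgen (Lower b) * fgen (Lower c) \<in> Uq_ideal m n P qp"
    by (rule Uq_relators_far(1)) (use less.prems in auto)
  show ?case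
  proof (cases "a = c + 1")
    case True
    then show ?thesis using base by (simp add: free_E.simps)
  next
    case False
    have "free_E m qp (c+1) c = fgen (Lower c)" by (simp add: free_E.simps)
    with False less.prems have e: "free_E m qp a c = free_E m qp a (c+1) * fgen (Lower c)
        - scale (qa m qp (c+1) 1) (fgen (Lower c) * free_E m qp a (c+1))"
      by (subst free_E.simps) (auto simp: Let_def)
    show ?thesis unfolding e
      by (intro comm_lin comm_mult base less.hyps Uq_free_closed free_E_closed)
         (use less.prems False in \<open>auto simp: gens_def\<close>)
  qed
qed

lemma comm_raise:
  assumes "1 \<le> a" "a + 1 < c" "c < b" "b \<le> m + n"
  shows "free_E m qp c b * fgen (Raise a) - fgen (Raise a) * free_E m qp c b \<in> Uq_ideal m n P qp"
  using assms
proof (induction "b - c" arbitrary: c rule: less_induct)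
  case less
  have base: "fgen (Raise c) * fgen (Raise a) - fgen (Raise a) * fgen (Raise c) \<in> Uq_ideal m n P qp"
    by (rule Uq_relators_far(2)) (use less.prems in auto)
  show ?case
  proof (cases "b = c + 1")
    case True
    then show ?thesis using base by (simp add: free_E.simps)
  next
    case False
    have "free_E m qp c (c+1) = fgen (Raise c)" by (simp add: free_E.simps)
    with False less.prems have e: "free_E m qp c b = fgen (Raise c) * free_E m qp (c+1) b
        - scale (qa m qp (c+1) (-1)) (free_E m qp (c+1) b * fgen (Raise c))"
      by (subst free_E.simps) (auto simp: Let_def)
    show ?thesis unfolding e
      by (intro comm_lin comm_mult base less.hyps Uq_free_closed free_E_closed)
         (use less.prems False in \<open>auto simp: gens_def\<close>)
  qed
qed

lemma lower_indep:
  assumes "1 \<le> b" "b < c" "c < a" "a \<le> m + n"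
  shows "free_E m qp a b - (free_E m qp a c * free_E m qp c b
     - scale (qa m qp c 1) (free_E m qp c b * free_E m qp a c)) \<in> Uq_ideal m n P qp"
  using assms
proof (induction "a - b" arbitrary: b rule: less_induct)
  case less
  let ?d = "b + 1" let ?L = "fgen (Lower b)"
  have L: "free_E m qp ?d b = ?L" by (simp add: free_E.simps)
  have e: "free_E m qp a' b = free_E m qp a' ?d * ?L - scale (qa m qp ?d 1) (?L * free_E m qp a' ?d)"
    if "?d < a'" for a'
    using that L by (subst free_E.simps) (auto simp: Let_def)
  show ?case
  proof (cases "c = ?d")
    case True
    then show ?thesis using e[of a] L less.prems by (simp add: Uq_ideal_closed(1))
  next
    case False
    define A where "A = free_E m qp a c"
    define D where "D = free_E m qp c ?d"
    define E where "E = free_E m qp a ?d"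
    have ih: "E - (A * D - scale (qa m qp c 1) (D * A)) \<in> Uq_ideal m n P qp" (is "?x \<in> Uq_ideal m n P qp")
      unfolding A_def D_def E_def by (rule less.hyps) (use less.prems False in auto)
    have cm: "A * ?L - ?L * A \<in> Uq_ideal m n P qp" (is "?y \<in> Uq_ideal m n P qp")
      unfolding A_def by (rule comm_lower) (use less.prems False in auto)
    have cl: "D \<in> carrier (Uq_free m n P)" "?L \<in> carrier (Uq_free m n P)"
      unfolding D_def by (intro free_E_closed Uq_free_closed; use less.prems False in \<open>auto simp: gens_def\<close>)+
    have ea: "free_E m qp a b = E * ?L - scale (qa m qp ?d 1) (?L * E)"
      unfolding E_def by (rule e) (use less.prems False in auto)
    have ec: "free_E m qp c b = D * ?L - scale (qa m qp ?d 1) (?L * D)"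
      unfolding D_def by (rule e) (use less.prems False in auto)
    have "free_E m qp a b - (A * free_E m qp c b - scale (qa m qp c 1) (free_E m qp c b * A)) =
      ?x * ?L - scale (qa m qp ?d 1) (?L * ?x) + scale (qa m qp ?d 1) (?y * D) - scale (qa m qp c 1) (D * ?y)"
      unfolding ea ec by (simp only: algebra_simps scale_alg)
    also have "\<dots> \<in> Uq_ideal m n P qp"
      by (intro Uq_ideal_closed(2,4-8) ih cm cl)
    finally show ?thesis unfolding A_def .
  qed
qed

lemma raise_indep:
  assumes "1 \<le> a" "a < c" "c < b" "b \<le> m + n"
  shows "free_E m qp a b - (free_E m qp a c * free_E m qp c b
     - scale (qa m qp c (-1)) (free_E m qp c b * free_E m qp a c)) \<in> Uq_ideal m n P qp"
  using assms
proof (induction "b - a" arbitrary: a rule: less_induct)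
  case less
  let ?d = "a + 1" let ?R = "fgen (Raise a)"
  have R: "free_E m qp a ?d = ?R" by (simp add: free_E.simps)
  have e: "free_E m qp a b' = ?R * free_E m qp ?d b' - scale (qa m qp ?d (-1)) (free_E m qp ?d b' * ?R)"
    if "?d < b'" for b'
    using that R by (subst free_E.simps) (auto simp: Let_def)
  show ?case
  proof (cases "c = ?d")
    case True
    then show ?thesis using e[of b] R less.prems by (simp add: Uq_ideal_closed(1))
  next
    case False
    define A where "A = free_E m qp c b"
    define D where "D = free_E m qp ?d c"
    define E where "E = free_E m qp ?d b"
    have ih: "E - (D * A - scale (qa m qp c (-1)) (A * D)) \<in> Uq_ideal m n P qp" (is "?x \<in> Uq_ideal m n P qp")
      unfolding A_def D_def E_def by (rule less.hyps) (use less.prems False in auto)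
    have cm: "A * ?R - ?R * A \<in> Uq_ideal m n P qp" (is "?y \<in> Uq_ideal m n P qp")
      unfolding A_def by (rule comm_raise) (use less.prems False in auto)
    have cl: "D \<in> carrier (Uq_free m n P)" "?R \<in> carrier (Uq_free m n P)"
      unfolding D_def by (intro free_E_closed Uq_free_closed; use less.prems False in \<open>auto simp: gens_def\<close>)+
    have eb: "free_E m qp a b = ?R * E - scale (qa m qp ?d (-1)) (E * ?R)"
      unfolding E_def by (rule e) (use less.prems False in auto)
    have ec: "free_E m qp a c = ?R * D - scale (qa m qp ?d (-1)) (D * ?R)"
      unfolding D_def by (rule e) (use less.prems False in auto)
    have "free_E m qp a b - (free_E m qp a c * A - scale (qa m qp c (-1)) (A * free_E m qp a c)) =
      ?R * ?x - scale (qa m qp ?d (-1)) (?x * ?R) - scale (qa m qp ?d (-1)) (D * ?y) + scale (qa m qp c (-1)) (?y * D)"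
      unfolding eb ec by (simp only: algebra_simps scale_alg)
    also have "\<dots> \<in> Uq_ideal m n P qp"
      by (intro Uq_ideal_closed(2,4-8) ih cm cl)
    finally show ?thesis unfolding A_def .
  qed
qed

lemma Uq_coset_mult:
  assumes "x \<in> carrier (Uq_free m n P)" "y \<in> carrier (Uq_free m n P)"
  shows "(Uq_ideal m n P qp +>\<^bsub>Uq_free m n P\<^esub> x) \<otimes>\<^bsub>Uq m n P qp\<^esub> (Uq_ideal m n P qp +>\<^bsub>Uq_free m n P\<^esub> y)
    = Uq_ideal m n P qp +>\<^bsub>Uq_free m n P\<^esub> (x * y)"
  using ideal.rcoset_mult_add[OF Uq_ideal_ideal assms]
  by (simp add: Uq_def quot_superalg_def FactRing_def Uq_free_simps)

lemma Uq_coset_mem: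
  "z \<in> Uq_ideal m n P qp +>\<^bsub>Uq_free m n P\<^esub> x \<longleftrightarrow> z - x \<in> Uq_ideal m n P qp"
proof
  assume "z \<in> Uq_ideal m n P qp +>\<^bsub>Uq_free m n P\<^esub> x"
  then obtain i where "i \<in> Uq_ideal m n P qp" "z = i + x"
    by (auto simp: a_r_coset_def' Uq_free_simps)
  then show "z - x \<in> Uq_ideal m n P qp" by simp
next
  assume "z - x \<in> Uq_ideal m n P qp"
  then have "(z - x) \<oplus>\<^bsub>Uq_free m n P\<^esub> x \<in> Uq_ideal m n P qp +>\<^bsub>Uq_free m n P\<^esub> x"
    unfolding a_r_coset_def' by blast
  then show "z \<in> Uq_ideal m n P qp +>\<^bsub>Uq_free m n P\<^esub> x" by (simp add: Uq_free_simps)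
qed

lemma Uq_coset_eqI:
  assumes "x \<in> carrier (Uq_free m n P)" "y \<in> carrier (Uq_free m n P)" "x - y \<in> Uq_ideal m n P qp"
  shows "Uq_ideal m n P qp +>\<^bsub>Uq_free m n P\<^esub> x = Uq_ideal m n P qp +>\<^bsub>Uq_free m n P\<^esub> y"
proof -
  have "z - x \<in> Uq_ideal m n P qp \<longleftrightarrow> z - y \<in> Uq_ideal m n P qp" for z
    using Uq_ideal_closed(2)[OF _ assms(3), of "z - x"] Uq_ideal_closed(8)[OF _ assms(3), of "z - y"]
    by auto
  then show ?thesis using Uq_coset_mem by blast
qed

lemma Uq_coset_smult:
  assumes "x \<in> carrier (Uq_free m n P)"
  shows "c \<odot>\<^bsub>Uq m n P qp\<^esub> (Uq_ideal m n P qp +>\<^bsub>Uq_free m n P\<^esub> x)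
    = Uq_ideal m n P qp +>\<^bsub>Uq_free m n P\<^esub> scale c x"
proof -
  have *: "Uq_ideal m n P qp +>\<^bsub>Uq_free m n P\<^esub> scale c y = Uq_ideal m n P qp +>\<^bsub>Uq_free m n P\<^esub> scale c x"
    if "y \<in> Uq_ideal m n P qp +>\<^bsub>Uq_free m n P\<^esub> x" for y
  proof -
    from that obtain i where i: "i \<in> Uq_ideal m n P qp" "y = i + x"
      by (auto simp: a_r_coset_def' Uq_free_simps)
    have y: "y \<in> carrier (Uq_free m n P)"
      unfolding i(2) by (rule Uq_free_closed(3)[OF Uq_ideal_closed(3)[OF i(1)] assms])
    have "scale c y - scale c x = scale c i"
      unfolding i(2) scale_alg by simp
    then have "scale c y - scale c x \<in> Uq_ideal m n P qp"
      using Uq_ideal_closed(6)[OF i(1)] by simp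
    then show ?thesis
      by (intro Uq_coset_eqI Uq_free_closed(6) y assms)
  qed
  have "x \<in> Uq_ideal m n P qp +>\<^bsub>Uq_free m n P\<^esub> x"
    using Uq_ideal_closed(1) by (simp add: Uq_coset_mem)
  then show ?thesis
    unfolding Uq_def quot_superalg_def Uq_free_simps superalg.simps module.simps using * by blast
qed

lemma Uq_coset_minus:
  assumes "x \<in> carrier (Uq_free m n P)" "y \<in> carrier (Uq_free m n P)"
  shows "(Uq_ideal m n P qp +>\<^bsub>Uq_free m n P\<^esub> x) \<ominus>\<^bsub>Uq m n P qp\<^esub> (Uq_ideal m n P qp +>\<^bsub>Uq_free m n P\<^esub> y)
    = Uq_ideal m n P qp +>\<^bsub>Uq_free m n P\<^esub> (x - y)"
proof -
  interpret I: ideal "Uq_ideal m n P qp" "Uq_free m n P" by (rule Uq_ideal_ideal)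
  interpret Q: ring "Uq_free m n P Quot Uq_ideal m n P qp" by (rule I.quotient_is_ring)
  let ?p = "\<lambda>z. Uq_ideal m n P qp +>\<^bsub>Uq_free m n P\<^esub> z"
  let ?Q = "Uq_free m n P Quot Uq_ideal m n P qp"
  have c: "?p z \<in> carrier ?Q" if "z \<in> carrier (Uq_free m n P)" for z
    using that by (auto simp: FactRing_def A_RCOSETS_def' a_r_coset_def')
  have "?p x = ?p (x - y) \<oplus>\<^bsub>?Q\<^esub> ?p y"
    using I.a_rcos_sum[of "x - y" y] assms by (simp add: FactRing_def Uq_free_simps Uq_free_closed)
  then have "?p x \<ominus>\<^bsub>?Q\<^esub> ?p y = ?p (x - y)"
    using assms c Uq_free_closed(4)[OF assms]
    by (simp only: Q.minus_eq Q.add.m_assoc Q.r_neg Q.r_zero Q.a_inv_closed)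
  moreover have "?p x \<ominus>\<^bsub>Uq m n P qp\<^esub> ?p y = ?p x \<ominus>\<^bsub>?Q\<^esub> ?p y"
    by (simp add: a_minus_def a_inv_def m_inv_def Uq_def quot_superalg_def)
  ultimately show ?thesis by simp
qed

lemma Uq_E_lower:
  assumes "1 \<le> b" "b < c" "c < a" "a \<le> m + n"
  shows "Uq_E m n P qp a b =
    Uq_E m n P qp a c \<otimes>\<^bsub>Uq m n P qp\<^esub> Uq_E m n P qp c b \<ominus>\<^bsub>Uq m n P qp\<^esub>
    qa m qp c 1 \<odot>\<^bsub>Uq m n P qp\<^esub> (Uq_E m n P qp c b \<otimes>\<^bsub>Uq m n P qp\<^esub> Uq_E m n P qp a c)"
proof -
  have "free_E m qp a b \<in> carrier (Uq_free m n P)" "free_E m qp a c \<in> carrier (Uq_free m n P)"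
    "free_E m qp c b \<in> carrier (Uq_free m n P)"
    using assms by (auto intro!: free_E_closed)
  note cl = this
  have "Uq_ideal m n P qp +>\<^bsub>Uq_free m n P\<^esub> free_E m qp a b = Uq_ideal m n P qp +>\<^bsub>Uq_free m n P\<^esub>
    (free_E m qp a c * free_E m qp c b - scale (qa m qp c 1) (free_E m qp c b * free_E m qp a c))"
    by (rule Uq_coset_eqI[OF _ _ lower_indep[OF assms]]) (intro Uq_free_closed cl)+
  then show ?thesis
    unfolding Uq_E_def using cl
    by (simp only: Uq_coset_mult Uq_coset_smult Uq_coset_minus Uq_free_closed)
qed

lemma Uq_E_raise:
  assumes "1 \<le> a" "a < c" "c < b" "b \<le> m + n"
  shows "Uq_E m n P qp a b =
    Uq_E m n P qp a c \<otimes>\<^bsub>Uq m n P qp\<^esub> Uq_E m n P qp c b \<ominus>\<^bsub>Uq m n P qp\<^esub>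
    qa m qp c (- 1) \<odot>\<^bsub>Uq m n P qp\<^esub> (Uq_E m n P qp c b \<otimes>\<^bsub>Uq m n P qp\<^esub> Uq_E m n P qp a c)"
proof -
  have "free_E m qp a b \<in> carrier (Uq_free m n P)" "free_E m qp a c \<in> carrier (Uq_free m n P)"
    "free_E m qp c b \<in> carrier (Uq_free m n P)"
    using assms by (auto intro!: free_E_closed)
  note cl = this
  have "Uq_ideal m n P qp +>\<^bsub>Uq_free m n P\<^esub> free_E m qp a b = Uq_ideal m n P qp +>\<^bsub>Uq_free m n P\<^esub>
    (free_E m qp a c * free_E m qp c b - scale (qa m qp c (- 1)) (free_E m qp c b * free_E m qp a c))"
    by (rule Uq_coset_eqI[OF _ _ raise_indep[OF assms]]) (intro Uq_free_closed cl)+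
  then show ?thesis
    unfolding Uq_E_def using cl
    by (simp only: Uq_coset_mult Uq_coset_smult Uq_coset_minus Uq_free_closed)
qed

end

end

theory Submission
  imports Defs
begin

text \<open>
  Lowering (\<open>a > b\<close>) and raising (\<open>a < b\<close>) are one computation with a sign \<open>s = \<plusminus>1\<close>. Put
  \<open>k\<^sub>x\<^sub>y = K\<^sub>x\<^bsup>s/2\<^esup> K\<^sub>y\<^bsup>-s/2\<^esup>\<close>. These elements commute with each other and satisfy
  \<open>k\<^sub>x\<^sub>y k\<^sub>y\<^sub>z = k\<^sub>x\<^sub>z\<close>, and the claimed formula becomes
  \<open>\<Delta>(E\<^sup>a\<^sub>b) = E\<^sup>a\<^sub>b \<otimes> k\<^sub>a\<^sub>b + k\<^sub>b\<^sub>a \<otimes> E\<^sup>a\<^sub>b - s \<Sum>\<^sub>c (q\<^sub>c - q\<^sub>c\<^sup>-\<^sup>1) X\<^sub>c\<close> with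
  \<open>X\<^sub>c = k\<^sub>b\<^sub>c E\<^sup>a\<^sub>c \<otimes> E\<^sup>c\<^sub>b k\<^sub>a\<^sub>c\<close>.

  The proof is by induction on \<open>|a - b|\<close>, splitting \<open>E\<^sup>a\<^sub>b = E\<^sup>a\<^sub>c E\<^sup>c\<^sub>b - q\<^sub>c\<^sup>s E\<^sup>c\<^sub>b E\<^sup>a\<^sub>c\<close> at the index \<open>c\<close> next
  to \<open>b\<close>. Then \<open>\<Delta>(E\<^sup>c\<^sub>b)\<close> has only its two outer terms, and \<open>\<Delta>(E\<^sup>a\<^sub>b)\<close> is the twisted commutator of
  \<open>\<Delta>(E\<^sup>a\<^sub>c)\<close> and \<open>\<Delta>(E\<^sup>c\<^sub>b)\<close>. Among the commutators of the individual terms (\<open>qcomm_11\<close> to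
  \<open>qcomm_middle_2\<close>), the two of equal type rebuild \<open>E\<^sup>a\<^sub>b \<otimes> k\<^sub>a\<^sub>b\<close> and \<open>k\<^sub>b\<^sub>a \<otimes> E\<^sup>a\<^sub>b\<close>; one of the mixed ones
  vanishes and the other one is \<open>(q\<^sub>c\<^sup>-\<^sup>s - q\<^sub>c\<^sup>s) X\<^sub>c = - s (q\<^sub>c - q\<^sub>c\<^sup>-\<^sup>1) X\<^sub>c\<close>, the new summand; and each middle
  term of \<open>\<Delta>(E\<^sup>a\<^sub>c)\<close> yields the middle term of \<open>\<Delta>(E\<^sup>a\<^sub>b)\<close> with the same intermediate index. This uses the weights of the
  root vectors under the Cartan elements (\<open>K_E\<close>) and that \<open>E\<^sup>a\<^sub>d\<close> commutes with \<open>E\<^sup>c\<^sub>b\<close> when \<open>d\<close> lies strictly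
  between \<open>a\<close> and \<open>c\<close> (\<open>E_far_comm\<close>). No sign ever appears: the parity is monotone in the index, so of two
  root vectors belonging to non-overlapping index intervals at most one is odd.

  For this the product of the graded tensor product must be well defined. The latter is a quotient of the
  free vector space on pairs by the bilinearity relations, and its product is defined through homogeneous
  components. The product descends to the quotient (\<open>pmult_cong\<close>) because taking homogeneous components is
  a linear operation in a superalgebra, and \<open>U\<^sub>q[gl(m|n)]\<close> is a superalgebra (\<open>Uq_superalgebra\<close>) because its
  defining relations are homogeneous. Identities in the tensor product are then proved as
  congruences between formal sums of pairs.
\<close>

section \<open>Superalgebras\<close>

locale superalgebra = ring A for A :: "'a superalg" (structure) +
  assumes smult_closed [simp, intro]: "x \<in> carrier A \<Longrightarrow> c \<odot> x \<in> carrier A"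
    and smult_r_distr: "x \<in> carrier A \<Longrightarrow> y \<in> carrier A \<Longrightarrow> c \<odot> (x \<oplus> y) = c \<odot> x \<oplus> c \<odot> y"
    and smult_l_distr: "x \<in> carrier A \<Longrightarrow> (c + c') \<odot> x = c \<odot> x \<oplus> c' \<odot> x"
    and smult_smult: "x \<in> carrier A \<Longrightarrow> c \<odot> (c' \<odot> x) = (c * c') \<odot> x"
    and smult_one [simp]: "x \<in> carrier A \<Longrightarrow> 1 \<odot> x = x"
    and smult_mult_l: "x \<in> carrier A \<Longrightarrow> y \<in> carrier A \<Longrightarrow> (c \<odot> x) \<otimes> y = c \<odot> (x \<otimes> y)"
    and smult_mult_r: "x \<in> carrier A \<Longrightarrow> y \<in> carrier A \<Longrightarrow> x \<otimes> (c \<odot> y) = c \<odot> (x \<otimes> y)"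
    and homog_carrier: "x \<in> homog A d \<Longrightarrow> x \<in> carrier A"
    and homog_add: "x \<in> homog A d \<Longrightarrow> y \<in> homog A d \<Longrightarrow> x \<oplus> y \<in> homog A d"
    and homog_smult: "x \<in> homog A d \<Longrightarrow> c \<odot> x \<in> homog A d"
    and homog_mult: "x \<in> homog A d \<Longrightarrow> y \<in> homog A e \<Longrightarrow> x \<otimes> y \<in> homog A (d + e)"
    and homog_decomp: "x \<in> carrier A \<Longrightarrow> \<exists>y\<in>homog A 0. \<exists>z\<in>homog A 1. x = y \<oplus> z"
    and homog_disjoint: "x \<in> homog A 0 \<Longrightarrow> x \<in> homog A 1 \<Longrightarrow> x = \<zero>"
begin

lemma smult_zero [simp]:
  assumes "x \<in> carrier A"
  shows "0 \<odot> x = \<zero>"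
proof -
  have "0 \<odot> x \<oplus> 0 \<odot> x = 0 \<odot> x" using smult_l_distr[OF assms, of 0 0] by simp
  then show ?thesis using assms by (metis smult_closed add.r_cancel_one')
qed

lemma smult_minus_one:
  assumes "x \<in> carrier A"
  shows "(- 1) \<odot> x = \<ominus> x"
proof -
  have "(- 1) \<odot> x \<oplus> x = \<zero>" using smult_l_distr[OF assms, of "-1" 1] assms by simp
  then show ?thesis using assms by (simp add: minus_equality)
qed

lemma smult_neg:
  assumes "x \<in> carrier A"
  shows "(- c) \<odot> x = \<ominus> (c \<odot> x)"
  using assms smult_smult[of x "- 1" c] smult_minus_one[of "c \<odot> x"] by simp

lemma homog_zero: "\<zero> \<in> homog A d"
proof -
  obtain x0 x1 where "x0 \<in> homog A 0" "x1 \<in> homog A 1" using homog_decomp[of \<zero>] by auto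
  then show ?thesis using homog_smult[of _ _ 0] homog_carrier by (cases d) force+
qed

lemma homog_minus: "x \<in> homog A d \<Longrightarrow> y \<in> homog A d \<Longrightarrow> x \<ominus> y \<in> homog A d"
  using homog_smult[of y d "-1"] homog_add[of x d] by (simp add: minus_eq smult_minus_one homog_carrier)

lemma homog_disjoint': "x \<in> homog A d \<Longrightarrow> x \<in> homog A (d + 1) \<Longrightarrow> x = \<zero>"
  by (cases d) (auto intro: homog_disjoint)

text \<open>
  The definite description in \<^const>\<open>homog_comp\<close> is met by exactly one element, as
  the two homogeneous parts intersect only in zero.
\<close>

lemma homog_comp_eqI:
  assumes y: "y \<in> homog A d" and z: "z \<in> homog A (d + 1)" and x: "x = y \<oplus> z"
  shows "homog_comp A d x = y"
  unfolding homog_comp_def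
proof (rule the_equality)
  note c = homog_carrier[OF y] homog_carrier[OF z]
  have e: "x \<ominus> y = z" unfolding x minus_eq using c by (simp add: a_comm a_assoc[symmetric] r_neg a_ac)
  show "y \<in> homog A d \<and> x \<ominus> y \<in> homog A (d + 1)" using y z e by simp
  fix w assume w: "w \<in> homog A d \<and> x \<ominus> w \<in> homog A (d + 1)"
  then have cw: "w \<in> carrier A" by (auto intro: homog_carrier)
  have "w \<ominus> y = z \<ominus> (x \<ominus> w)" unfolding x using c cw by algebra
  then have "w \<ominus> y = \<zero>"
    using w y z homog_minus homog_disjoint'[of "w \<ominus> y" d] by metis
  then show "w = y" using c cw by (simp add: minus_eq add.inv_solve_right')
qed

lemma homog_decomp':
  assumes "x \<in> carrier A"
  obtains y z where "y \<in> homog A d" "z \<in> homog A (d + 1)" "x = y \<oplus> z"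
proof -
  obtain y z where "y \<in> homog A 0" "z \<in> homog A 1" "x = y \<oplus> z" using homog_decomp[OF assms] by blast
  moreover have "y \<oplus> z = z \<oplus> y" using calculation by (intro a_comm homog_carrier)
  ultimately show thesis using that by (cases d) auto
qed

lemma homog_comp_homog: "x \<in> carrier A \<Longrightarrow> homog_comp A d x \<in> homog A d"
  by (metis homog_comp_eqI homog_decomp')

lemma homog_comp_closed [simp, intro]: "x \<in> carrier A \<Longrightarrow> homog_comp A d x \<in> carrier A"
  by (rule homog_carrier[OF homog_comp_homog])

lemma homog_comp_add:
  assumes "x \<in> carrier A" "y \<in> carrier A"
  shows "homog_comp A d (x \<oplus> y) = homog_comp A d x \<oplus> homog_comp A d y"
proof -
  obtain x0 x1 where x: "x0 \<in> homog A d" "x1 \<in> homog A (d + 1)" "x = x0 \<oplus> x1"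
    by (rule homog_decomp'[OF assms(1)])
  obtain y0 y1 where y: "y0 \<in> homog A d" "y1 \<in> homog A (d + 1)" "y = y0 \<oplus> y1"
    by (rule homog_decomp'[OF assms(2)])
  have "x \<oplus> y = (x0 \<oplus> y0) \<oplus> (x1 \<oplus> y1)"
    unfolding x y using x(1,2) y(1,2) by (simp add: homog_carrier a_ac)
  then show ?thesis
    using homog_comp_eqI[OF x] homog_comp_eqI[OF y]
      homog_comp_eqI[OF homog_add[OF x(1) y(1)] homog_add[OF x(2) y(2)]] by simp
qed

lemma homog_comp_smult:
  assumes "x \<in> carrier A"
  shows "homog_comp A d (c \<odot> x) = c \<odot> homog_comp A d x"
proof -
  obtain y z where x: "y \<in> homog A d" "z \<in> homog A (d + 1)" "x = y \<oplus> z"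
    by (rule homog_decomp'[OF assms(1)])
  have "c \<odot> x = c \<odot> y \<oplus> c \<odot> z"
    unfolding x using x(1,2) by (simp add: homog_carrier smult_r_distr)
  then show ?thesis
    using homog_comp_eqI[OF x] homog_comp_eqI[OF homog_smult[OF x(1)] homog_smult[OF x(2)]] by simp
qed

lemma homog_comp_of_homog:
  assumes "x \<in> homog A d"
  shows "homog_comp A e x = (if e = d then x else \<zero>)"
proof (cases "e = d")
  case True
  then show ?thesis using homog_comp_eqI[OF assms homog_zero] homog_carrier[OF assms] by simp
next
  case False
  then have "d = e + 1" by (cases d; cases e) auto
  then show ?thesis using False homog_comp_eqI[OF homog_zero[of e], of x x] homog_carrier[OF assms] assms by simp
qed

end

section \<open>Graded tensor products\<close>

interpretation formal: Modules.module "scale :: complex \<Rightarrow> ('k \<Rightarrow>\<^sub>0 complex) \<Rightarrow> _"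
  by standard (rule poly_mapping_eqI; simp add: lookup_add algebra_simps)+

lemma scale_single: "scale c (Poly_Mapping.single k d) = Poly_Mapping.single k (c * d)"
  by (rule poly_mapping_eqI) (simp add: lookup_single when_def)

lemma sum_single_lookup:
  fixes v :: "'k \<Rightarrow>\<^sub>0 complex"
  shows "v = (\<Sum>k\<in>Poly_Mapping.keys v. scale (Poly_Mapping.lookup v k) (Poly_Mapping.single k 1))"
  by (rule poly_mapping_eqI) (simp add: lookup_sum lookup_single when_def in_keys_iff if_distrib cong: if_cong)

lemma koszul_zero [simp]: "koszul 0 e = 1" "koszul d 0 = 1"
  by (simp_all add: koszul_def)

locale superalgebra_pair = A: superalgebra A + B: superalgebra B
  for A :: "'a superalg" and B :: "'b superalg"
begin

abbreviation "Null \<equiv> tensor_null A B"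
abbreviation "Pre \<equiv> carrier (pretensor A B)"
abbreviation "T \<equiv> tensor_superalg A B"
abbreviation "pmult \<equiv> mult (pretensor A B)"
abbreviation pure :: "'a \<Rightarrow> 'b \<Rightarrow> ('a \<times> 'b \<Rightarrow>\<^sub>0 complex)"
  where "pure x y \<equiv> Poly_Mapping.single (x, y) 1"

definition cls :: "('a \<times> 'b \<Rightarrow>\<^sub>0 complex) \<Rightarrow> ('a \<times> 'b \<Rightarrow>\<^sub>0 complex) set"
  where "cls v = Null +>\<^bsub>pretensor A B\<^esub> v"

text \<open>
  Working with this congruence instead of equality of classes leaves all sums and scalar multiples in
  an ordinary vector space type, where only the pairs themselves are bound to carriers.
\<close>

definition cong :: "('a \<times> 'b \<Rightarrow>\<^sub>0 complex) \<Rightarrow> ('a \<times> 'b \<Rightarrow>\<^sub>0 complex) \<Rightarrow> bool" (infix "\<approx>" 50)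
  where "v \<approx> w \<longleftrightarrow> v - w \<in> Null"

lemma Pre_def: "Pre = {v. Poly_Mapping.keys v \<subseteq> carrier A \<times> carrier B}"
  by (simp add: pretensor_def)

lemma Pre_subspace: "formal.subspace Pre"
  unfolding Pre_def formal.subspace_def
  by (auto dest!: set_mp[OF keys_add] set_mp[OF keys_scale])

lemma Pre_closed [simp, intro]:
  "0 \<in> Pre" "v \<in> Pre \<Longrightarrow> w \<in> Pre \<Longrightarrow> v + w \<in> Pre" "v \<in> Pre \<Longrightarrow> w \<in> Pre \<Longrightarrow> v - w \<in> Pre" "v \<in> Pre \<Longrightarrow> scale c v \<in> Pre"
  "(\<And>i. i \<in> S \<Longrightarrow> f i \<in> Pre) \<Longrightarrow> sum f S \<in> Pre"
  using Pre_subspace formal.subspace_0 formal.subspace_add formal.subspace_diff formal.subspace_scale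
    formal.subspace_sum by blast+

lemma pure_Pre [simp, intro]: "x \<in> carrier A \<Longrightarrow> y \<in> carrier B \<Longrightarrow> pure x y \<in> Pre"
  by (simp add: Pre_def)

lemma Null_closed:
  "0 \<in> Null" "v \<in> Null \<Longrightarrow> w \<in> Null \<Longrightarrow> v + w \<in> Null" "v \<in> Null \<Longrightarrow> w \<in> Null \<Longrightarrow> v - w \<in> Null" "v \<in> Null \<Longrightarrow> scale c v \<in> Null"
  "v \<in> Null \<Longrightarrow> - v \<in> Null" "(\<And>i. i \<in> S \<Longrightarrow> f i \<in> Null) \<Longrightarrow> sum f S \<in> Null"
  unfolding tensor_null_def
  by (auto intro: formal.span_zero formal.span_add formal.span_diff formal.span_scale formal.span_neg formal.span_sum)

lemma cong_refl [simp, intro]: "v \<approx> v"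
  and cong_sym: "v \<approx> w \<Longrightarrow> w \<approx> v"
  and cong_trans [trans]: "u \<approx> v \<Longrightarrow> v \<approx> w \<Longrightarrow> u \<approx> w"
  and cong_add: "v \<approx> w \<Longrightarrow> v' \<approx> w' \<Longrightarrow> v + v' \<approx> w + w'"
  and cong_diff: "v \<approx> w \<Longrightarrow> v' \<approx> w' \<Longrightarrow> v - v' \<approx> w - w'"
  and cong_scale: "v \<approx> w \<Longrightarrow> scale c v \<approx> scale c w"
  and cong_sum: "(\<And>i. i \<in> S \<Longrightarrow> f i \<approx> g i) \<Longrightarrow> sum f S \<approx> sum g S"
proof -
  show "v \<approx> v" by (simp add: cong_def Null_closed)
  show "v \<approx> w \<Longrightarrow> w \<approx> v" using Null_closed(5)[of "v - w"] by (simp add: cong_def)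
  show "u \<approx> v \<Longrightarrow> v \<approx> w \<Longrightarrow> u \<approx> w" using Null_closed(2)[of "u - v" "v - w"] by (simp add: cong_def)
  show "v \<approx> w \<Longrightarrow> v' \<approx> w' \<Longrightarrow> v + v' \<approx> w + w'"
    using Null_closed(2)[of "v - w" "v' - w'"] by (simp add: cong_def algebra_simps)
  show "v \<approx> w \<Longrightarrow> v' \<approx> w' \<Longrightarrow> v - v' \<approx> w - w'"
    using Null_closed(3)[of "v - w" "v' - w'"] by (simp add: cong_def algebra_simps)
  show "v \<approx> w \<Longrightarrow> scale c v \<approx> scale c w"
    using Null_closed(4)[of "v - w"] by (simp add: cong_def formal.scale_right_diff_distrib)
  show "(\<And>i. i \<in> S \<Longrightarrow> f i \<approx> g i) \<Longrightarrow> sum f S \<approx> sum g S"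
    using Null_closed(6)[of S "\<lambda>i. f i - g i"] by (simp add: cong_def sum_subtractf)
qed

lemma relators_Null: "r \<in> bilinear_relators A B \<Longrightarrow> r \<in> Null"
  unfolding tensor_null_def by (rule formal.span_base)

lemma pure_add_l: "x \<in> carrier A \<Longrightarrow> x' \<in> carrier A \<Longrightarrow> y \<in> carrier B \<Longrightarrow> pure (x \<oplus>\<^bsub>A\<^esub> x') y \<approx> pure x y + pure x' y"
  and pure_add_r: "x \<in> carrier A \<Longrightarrow> y \<in> carrier B \<Longrightarrow> y' \<in> carrier B \<Longrightarrow> pure x (y \<oplus>\<^bsub>B\<^esub> y') \<approx> pure x y + pure x y'"
  and pure_smult_l: "x \<in> carrier A \<Longrightarrow> y \<in> carrier B \<Longrightarrow> pure (c \<odot>\<^bsub>A\<^esub> x) y \<approx> scale c (pure x y)"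
  and pure_smult_r: "x \<in> carrier A \<Longrightarrow> y \<in> carrier B \<Longrightarrow> pure x (c \<odot>\<^bsub>B\<^esub> y) \<approx> scale c (pure x y)"
  unfolding cong_def
  by (rule relators_Null; unfold bilinear_relators_def Let_def diff_diff_eq; blast)+

lemma Null_subset_Pre: "Null \<subseteq> Pre"
  unfolding tensor_null_def
proof (rule formal.span_minimal[OF _ Pre_subspace])
  show "bilinear_relators A B \<subseteq> Pre"
    unfolding bilinear_relators_def Let_def by auto
qed

lemma pure_zero_l: "y \<in> carrier B \<Longrightarrow> pure \<zero>\<^bsub>A\<^esub> y \<approx> 0"
  using pure_smult_l[of "\<zero>\<^bsub>A\<^esub>" y 0] by simp

lemma pure_zero_r: "x \<in> carrier A \<Longrightarrow> pure x \<zero>\<^bsub>B\<^esub> \<approx> 0"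
  using pure_smult_r[of x "\<zero>\<^bsub>B\<^esub>" 0] by simp

subsection \<open>Multiplication\<close>

text \<open>
  The value of the product of the pretensor algebra on two basis vectors; the product is its bilinear extension.
\<close>

definition key_mult :: "'a \<times> 'b \<Rightarrow> 'a \<times> 'b \<Rightarrow> ('a \<times> 'b \<Rightarrow>\<^sub>0 complex)"
  where "key_mult k l = (\<Sum>i\<in>{0, 1}. \<Sum>j\<in>{0, 1}. scale (koszul i j)
     (pure (fst k \<otimes>\<^bsub>A\<^esub> homog_comp A j (fst l)) (homog_comp B i (snd k) \<otimes>\<^bsub>B\<^esub> snd l)))"

lemma pmult_eq: "pmult v w = (\<Sum>k\<in>Poly_Mapping.keys v. \<Sum>l\<in>Poly_Mapping.keys w.
    scale (Poly_Mapping.lookup v k * Poly_Mapping.lookup w l) (key_mult k l))"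
  unfolding pretensor_def key_mult_def
  by (simp add: case_prod_beta scale_single formal.scale_sum_right formal.scale_right_distrib mult_ac)

text \<open>
  Extending both index sets to common finite supersets makes the product visibly bilinear, although
  the supports of sums depend on cancellation.
\<close>

lemma pmult_superset:
  assumes "finite S" "finite S'" "Poly_Mapping.keys v \<subseteq> S" "Poly_Mapping.keys w \<subseteq> S'"
  shows "pmult v w = (\<Sum>k\<in>S. \<Sum>l\<in>S'. scale (Poly_Mapping.lookup v k * Poly_Mapping.lookup w l) (key_mult k l))"
proof -
  have "(\<Sum>l\<in>Poly_Mapping.keys w. scale (c * Poly_Mapping.lookup w l) (key_mult k l)) =
    (\<Sum>l\<in>S'. scale (c * Poly_Mapping.lookup w l) (key_mult k l))" for c k
    by (rule sum.mono_neutral_left) (use assms in \<open>auto simp: in_keys_iff\<close>)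
  then show ?thesis unfolding pmult_eq
    by (simp, intro sum.mono_neutral_left) (use assms in \<open>auto simp: in_keys_iff\<close>)
qed

lemma pmult_pure: "pmult (pure x y) (pure x' y') = key_mult (x, y) (x', y')"
  by (simp add: pmult_eq)

lemma pmult_add_l: "pmult (v + v') w = pmult v w + pmult v' w"
proof -
  let ?S = "Poly_Mapping.keys v \<union> Poly_Mapping.keys v'"
  have "Poly_Mapping.keys (v + v') \<subseteq> ?S" by (rule keys_add)
  then show ?thesis
    by (subst (1 2 3) pmult_superset[of ?S "Poly_Mapping.keys w"])
      (auto simp: lookup_add distrib_right formal.scale_left_distrib sum.distrib)
qed

lemma pmult_add_r: "pmult w (v + v') = pmult w v + pmult w v'"
proof -
  let ?S = "Poly_Mapping.keys v \<union> Poly_Mapping.keys v'"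
  have "Poly_Mapping.keys (v + v') \<subseteq> ?S" by (rule keys_add)
  then show ?thesis
    by (subst (1 2 3) pmult_superset[of "Poly_Mapping.keys w" ?S])
      (auto simp: lookup_add distrib_left formal.scale_left_distrib sum.distrib)
qed

lemma pmult_scale_l: "pmult (scale c v) w = scale c (pmult v w)"
  by (subst (1 2) pmult_superset[of "Poly_Mapping.keys v" "Poly_Mapping.keys w"])
    (auto simp: formal.scale_sum_right mult_ac dest!: set_mp[OF keys_scale])

lemma pmult_scale_r: "pmult v (scale c w) = scale c (pmult v w)"
  by (subst (1 2) pmult_superset[of "Poly_Mapping.keys v" "Poly_Mapping.keys w"])
    (auto simp: formal.scale_sum_right mult_ac dest!: set_mp[OF keys_scale])

lemma pmult_zero [simp]: "pmult 0 w = 0" "pmult v 0 = 0"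
  by (simp_all add: pmult_eq)

lemma pmult_diff_l: "pmult (v - v') w = pmult v w - pmult v' w"
  using pmult_add_l[of "v - v'" v' w] by (simp add: algebra_simps)

lemma pmult_diff_r: "pmult w (v - v') = pmult w v - pmult w v'"
  using pmult_add_r[of w "v - v'" v'] by (simp add: algebra_simps)

lemma pmult_sum_l: "pmult (sum f S) w = (\<Sum>i\<in>S. pmult (f i) w)"
  by (induction S rule: infinite_finite_induct) (auto simp: pmult_add_l)

lemma pmult_sum_r: "pmult w (sum f S) = (\<Sum>i\<in>S. pmult w (f i))"
  by (induction S rule: infinite_finite_induct) (auto simp: pmult_add_r)


text \<open>
  Additivity of the product in one of its four arguments, once it is known termwise; the shape of
  the double sum is that of \<^term>\<open>key_mult\<close>.
\<close>

lemma key_mult_additive: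
  assumes "\<And>i j. f i j \<approx> g i j + h i j"
  shows "(\<Sum>i\<in>I. \<Sum>j\<in>J. scale (koszul i j) (f i j)) \<approx>
    (\<Sum>i\<in>I. \<Sum>j\<in>J. scale (koszul i j) (g i j)) + (\<Sum>i\<in>I. \<Sum>j\<in>J. scale (koszul i j) (h i j))"
  unfolding sum.distrib[symmetric] formal.scale_right_distrib[symmetric]
  by (intro cong_sum cong_scale assms)

lemma key_mult_homogeneous:
  assumes "\<And>i j. f i j \<approx> scale c (g i j)"
  shows "(\<Sum>i\<in>I. \<Sum>j\<in>J. scale (koszul i j) (f i j)) \<approx>
    scale c (\<Sum>i\<in>I. \<Sum>j\<in>J. scale (koszul i j) (g i j))"
  unfolding formal.scale_sum_right formal.scale_scale mult.commute[of c]
  unfolding formal.scale_scale[symmetric] by (intro cong_sum cong_scale assms)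

lemma bilinear_relators_cases:
  assumes "r \<in> bilinear_relators A B"
  obtains
    (1) x y z where "x \<in> carrier A" "z \<in> carrier A" "y \<in> carrier B"
      "r = pure (x \<oplus>\<^bsub>A\<^esub> z) y - (pure x y + pure z y)"
  | (2) x y z where "x \<in> carrier A" "y \<in> carrier B" "z \<in> carrier B"
      "r = pure x (y \<oplus>\<^bsub>B\<^esub> z) - (pure x y + pure x z)"
  | (3) c x y where "x \<in> carrier A" "y \<in> carrier B" "r = pure (c \<odot>\<^bsub>A\<^esub> x) y - scale c (pure x y)"
  | (4) c x y where "x \<in> carrier A" "y \<in> carrier B" "r = pure x (c \<odot>\<^bsub>B\<^esub> y) - scale c (pure x y)"
  using assms unfolding bilinear_relators_def Let_def diff_diff_eq Un_iff mem_Collect_eq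
  by (elim disjE exE conjE) (rule that; assumption)+

text \<open>
  Multiplication by a fixed pair turns a bilinearity relation into a combination of relations of the
  same kind, because both the products and the homogeneous components are linear.
\<close>

lemma pmult_pure_Null_l:
  assumes r: "r \<in> bilinear_relators A B" and c: "x' \<in> carrier A" "y' \<in> carrier B"
  shows "pmult r (pure x' y') \<in> Null"
proof -
  from r show ?thesis
  proof (cases rule: bilinear_relators_cases)
    case 1
    show ?thesis
      unfolding 1(4) pmult_diff_l pmult_add_l cong_def[symmetric] pmult_pure key_mult_def fst_conv snd_conv
      by (rule key_mult_additive) (use 1 c in \<open>simp add: A.l_distr pure_add_l\<close>)
  next
    case 2
    show ?thesis
      unfolding 2(4) pmult_diff_l pmult_add_l cong_def[symmetric] pmult_pure key_mult_def fst_conv snd_conv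
      by (rule key_mult_additive) (use 2 c in \<open>simp add: B.l_distr B.homog_comp_add pure_add_r\<close>)
  next
    case 3
    show ?thesis
      unfolding 3(3) pmult_diff_l pmult_scale_l cong_def[symmetric] pmult_pure key_mult_def fst_conv snd_conv
      by (rule key_mult_homogeneous) (use 3 c in \<open>simp add: A.smult_mult_l pure_smult_l\<close>)
  next
    case 4
    show ?thesis
      unfolding 4(3) pmult_diff_l pmult_scale_l cong_def[symmetric] pmult_pure key_mult_def fst_conv snd_conv
      by (rule key_mult_homogeneous) (use 4 c in \<open>simp add: B.smult_mult_l B.homog_comp_smult pure_smult_r\<close>)
  qed
qed

lemma pmult_pure_Null_r:
  assumes r: "r \<in> bilinear_relators A B" and c: "x' \<in> carrier A" "y' \<in> carrier B"
  shows "pmult (pure x' y') r \<in> Null"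
proof -
  from r show ?thesis
  proof (cases rule: bilinear_relators_cases)
    case 1
    show ?thesis
      unfolding 1(4) pmult_diff_r pmult_add_r cong_def[symmetric] pmult_pure key_mult_def fst_conv snd_conv
      by (rule key_mult_additive) (use 1 c in \<open>simp add: A.r_distr A.homog_comp_add pure_add_l\<close>)
  next
    case 2
    show ?thesis
      unfolding 2(4) pmult_diff_r pmult_add_r cong_def[symmetric] pmult_pure key_mult_def fst_conv snd_conv
      by (rule key_mult_additive) (use 2 c in \<open>simp add: B.r_distr pure_add_r\<close>)
  next
    case 3
    show ?thesis
      unfolding 3(3) pmult_diff_r pmult_scale_r cong_def[symmetric] pmult_pure key_mult_def fst_conv snd_conv
      by (rule key_mult_homogeneous) (use 3 c in \<open>simp add: A.smult_mult_r A.homog_comp_smult pure_smult_l\<close>)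
  next
    case 4
    show ?thesis
      unfolding 4(3) pmult_diff_r pmult_scale_r cong_def[symmetric] pmult_pure key_mult_def fst_conv snd_conv
      by (rule key_mult_homogeneous) (use 4 c in \<open>simp add: B.smult_mult_r pure_smult_r\<close>)
  qed
qed

lemma pmult_Null_l:
  assumes v: "v \<in> Null" and w: "w \<in> Pre"
  shows "pmult v w \<in> Null"
  using v unfolding tensor_null_def[of A B]
proof (induction rule: formal.span_induct_alt)
  case base
  show ?case using Null_closed(1) by (simp add: tensor_null_def)
next
  case (step c r v)
  have "pmult r w = (\<Sum>k\<in>Poly_Mapping.keys w. scale (Poly_Mapping.lookup w k) (pmult r (Poly_Mapping.single k 1)))"
    by (subst sum_single_lookup[of w]) (simp add: pmult_sum_r pmult_scale_r)
  also have "\<dots> \<in> Null"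
    using w step.hyps by (intro Null_closed) (auto simp: Pre_def intro!: pmult_pure_Null_l)
  finally show ?case using step.IH
    by (auto simp: pmult_add_l pmult_scale_l tensor_null_def[symmetric] intro: Null_closed)
qed

lemma pmult_Null_r:
  assumes v: "v \<in> Null" and w: "w \<in> Pre"
  shows "pmult w v \<in> Null"
  using v unfolding tensor_null_def[of A B]
proof (induction rule: formal.span_induct_alt)
  case base
  show ?case using Null_closed(1) by (simp add: tensor_null_def)
next
  case (step c r v)
  have "pmult w r = (\<Sum>k\<in>Poly_Mapping.keys w. scale (Poly_Mapping.lookup w k) (pmult (Poly_Mapping.single k 1) r))"
    by (subst sum_single_lookup[of w]) (simp add: pmult_sum_l pmult_scale_l)
  also have "\<dots> \<in> Null"
    using w step.hyps by (intro Null_closed) (auto simp: Pre_def intro!: pmult_pure_Null_r)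
  finally show ?case using step.IH
    by (auto simp: pmult_add_r pmult_scale_r tensor_null_def[symmetric] intro: Null_closed)
qed

text \<open>
  The formal product is not associative, so the null space is not an ideal of a ring; that it
  absorbs products on both sides is nevertheless all that a well-defined product on the quotient
  requires.
\<close>

lemma pmult_cong:
  assumes "v \<approx> v'" "w \<approx> w'" "v' \<in> Pre" "w \<in> Pre"
  shows "pmult v w \<approx> pmult v' w'"
proof -
  have "pmult v w - pmult v' w' = pmult (v - v') w + pmult v' (w - w')"
    by (simp add: pmult_diff_l pmult_diff_r)
  then show ?thesis using assms unfolding cong_def by (simp add: Null_closed pmult_Null_l pmult_Null_r)
qed

text \<open>
  For homogeneous inner factors only one of the four component pairs survives, and the product
  reduces to the usual graded rule.
\<close>

lemma pmult_homog:
  assumes "x \<in> carrier A" "y \<in> homog B d" "x' \<in> homog A e" "y' \<in> carrier B"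
  shows "pmult (pure x y) (pure x' y') \<approx> scale (koszul d e) (pure (x \<otimes>\<^bsub>A\<^esub> x') (y \<otimes>\<^bsub>B\<^esub> y'))"
proof -
  let ?p = "pure (x \<otimes>\<^bsub>A\<^esub> x') (y \<otimes>\<^bsub>B\<^esub> y')"
  have "pmult (pure x y) (pure x' y') \<approx>
    (\<Sum>i\<in>{0, 1}. \<Sum>j\<in>{0, 1}. scale (koszul i j) (if i = d \<and> j = e then ?p else 0))"
    unfolding pmult_pure key_mult_def fst_conv snd_conv
    by (intro cong_sum cong_scale)
      (use assms in \<open>auto simp: A.homog_comp_of_homog B.homog_comp_of_homog A.homog_carrier B.homog_carrier
         intro: pure_zero_l pure_zero_r\<close>)
  also have "\<dots> = scale (koszul d e) ?p" by (cases d; cases e) auto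
  finally show ?thesis .
qed

lemma pmult_even:
  assumes "x \<in> carrier A" "y \<in> homog B d" "x' \<in> homog A e" "y' \<in> carrier B" "koszul d e = 1"
  shows "pmult (pure x y) (pure x' y') \<approx> pure (x \<otimes>\<^bsub>A\<^esub> x') (y \<otimes>\<^bsub>B\<^esub> y')"
  using pmult_homog[OF assms(1-4)] assms(5) by simp

subsection \<open>The quotient\<close>

lemma cls_eq: "cls v = {h + v | h. h \<in> Null}"
  by (auto simp: cls_def a_r_coset_def' pretensor_def)

lemma mem_cls: "w \<in> cls v \<longleftrightarrow> w \<approx> v"
proof
  assume "w \<approx> v"
  then have "w = (w - v) + v" "w - v \<in> Null" by (auto simp: cong_def)
  then show "w \<in> cls v" unfolding cls_eq by blast
qed (auto simp: cls_eq cong_def)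

lemma cls_eq_iff: "cls v = cls w \<longleftrightarrow> v \<approx> w"
  using mem_cls cong_refl cong_sym cong_trans by (metis (no_types, lifting) subsetI subset_antisym)

lemma tensor_elt_eq: "tensor_elt A B x y = cls (pure x y)"
  by (simp add: tensor_elt_def cls_def)

lemma cls_subset_Pre: "v \<in> Pre \<Longrightarrow> cls v \<subseteq> Pre"
  using Null_subset_Pre by (auto simp: cls_eq)

lemma T_carrier: "carrier T = cls ` Pre"
  by (auto simp: tensor_superalg_def quot_superalg_def FactRing_def A_RCOSETS_def' cls_def a_r_coset_def')

lemma cls_carrier [simp, intro]: "v \<in> Pre \<Longrightarrow> cls v \<in> carrier T"
  by (simp add: T_carrier)

lemma cls_add: "cls v \<oplus>\<^bsub>T\<^esub> cls w = cls (v + w)"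
proof -
  have "cls v \<oplus>\<^bsub>T\<^esub> cls w = {x + y | x y. x \<in> cls v \<and> y \<in> cls w}"
    by (auto simp: tensor_superalg_def quot_superalg_def FactRing_def set_add_def set_mult_def pretensor_def)
  also have "\<dots> = cls (v + w)"
  proof (intro Set.set_eqI iffI)
    fix z assume "z \<in> cls (v + w)"
    then have "z - w \<approx> v" by (simp add: mem_cls cong_def algebra_simps)
    moreover have "z = (z - w) + w" by simp
    ultimately show "z \<in> {x + y | x y. x \<in> cls v \<and> y \<in> cls w}" using mem_cls cong_refl by blast
  qed (auto simp: mem_cls intro: cong_add)
  finally show ?thesis .
qed

lemma cls_zero: "\<zero>\<^bsub>T\<^esub> = cls 0"
  by (auto simp: tensor_superalg_def quot_superalg_def FactRing_def cls_eq)

lemma cls_smult: "c \<odot>\<^bsub>T\<^esub> cls v = cls (scale c v)"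
proof -
  have "c \<odot>\<^bsub>T\<^esub> cls v = (\<Union>x\<in>cls v. cls (scale c x))"
    by (simp add: tensor_superalg_def quot_superalg_def cls_def pretensor_def)
  also have "\<dots> = cls (scale c v)"
    by (rule UN_constant_eq[of v]) (simp_all add: mem_cls cls_eq_iff cong_scale)
  finally show ?thesis .
qed

lemma cls_mult:
  assumes "v \<in> Pre" "w \<in> Pre"
  shows "cls v \<otimes>\<^bsub>T\<^esub> cls w = cls (pmult v w)"
proof -
  have "cls v \<otimes>\<^bsub>T\<^esub> cls w = (\<Union>x\<in>cls v. \<Union>y\<in>cls w. cls (pmult x y))"
    by (simp add: tensor_superalg_def quot_superalg_def FactRing_def rcoset_mult_def cls_def)
  also have "\<dots> = cls (pmult v w)"
  proof -
    have "cls (pmult x y) = cls (pmult v w)" if "x \<in> cls v" "y \<in> cls w" for x y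
      using that assms cls_subset_Pre[of w] unfolding cls_eq_iff by (intro pmult_cong) (auto simp: mem_cls)
    note e = this
    have "w \<in> cls w" "v \<in> cls v" by (simp_all add: mem_cls)
    then show ?thesis using e by (intro UN_constant_eq[OF \<open>v \<in> cls v\<close>] ballI UN_constant_eq[OF \<open>w \<in> cls w\<close>])
  qed
  finally show ?thesis .
qed

lemma T_abelian_group: "abelian_group T"
proof (rule abelian_groupI, goal_cases)
  case (6 x)
  then obtain v where v: "v \<in> Pre" "x = cls v" by (auto simp: T_carrier)
  then show ?case
    using Pre_closed(3)[OF Pre_closed(1) v(1)] by (intro bexI[of _ "cls (- v)"]) (auto simp: cls_add cls_zero)
qed (auto simp: T_carrier cls_add cls_zero add_ac)

lemma cls_diff:
  assumes "v \<in> Pre" "w \<in> Pre"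
  shows "cls v \<ominus>\<^bsub>T\<^esub> cls w = cls (v - w)"
proof -
  interpret T: abelian_group T by (rule T_abelian_group)
  have "- w \<in> Pre" using Pre_closed(3)[OF Pre_closed(1) assms(2)] by simp
  then have "\<ominus>\<^bsub>T\<^esub> cls w = cls (- w)"
    using assms by (intro T.minus_equality) (auto simp: cls_add cls_zero)
  then show ?thesis by (simp add: T.minus_eq cls_add)
qed

lemma cls_finsum:
  assumes "finite S" "\<And>i. i \<in> S \<Longrightarrow> f i \<in> Pre"
  shows "(\<Oplus>\<^bsub>T\<^esub>i\<in>S. cls (f i)) = cls (sum f S)"
proof -
  interpret T: abelian_group T by (rule T_abelian_group)
  show ?thesis using assms
    by (induction S rule: finite_induct) (auto simp: cls_zero cls_add Pi_def)
qed

subsection \<open>Twisted commutators\<close>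

lemma pure_smult2:
  assumes "x \<in> carrier A" "y \<in> carrier B"
  shows "pure (c \<odot>\<^bsub>A\<^esub> x) (d \<odot>\<^bsub>B\<^esub> y) \<approx> scale (c * d) (pure x y)"
proof -
  have "pure (c \<odot>\<^bsub>A\<^esub> x) (d \<odot>\<^bsub>B\<^esub> y) \<approx> scale c (pure x (d \<odot>\<^bsub>B\<^esub> y))"
    using assms by (intro pure_smult_l) auto
  also have "\<dots> \<approx> scale c (scale d (pure x y))"
    using assms by (intro cong_scale pure_smult_r)
  finally show ?thesis by simp
qed

lemma pure_diff_l:
  assumes "x \<in> carrier A" "x' \<in> carrier A" "y \<in> carrier B"
  shows "pure (x \<ominus>\<^bsub>A\<^esub> c \<odot>\<^bsub>A\<^esub> x') y \<approx> pure x y - scale c (pure x' y)"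
proof -
  have "pure (x \<oplus>\<^bsub>A\<^esub> (- c) \<odot>\<^bsub>A\<^esub> x') y \<approx> pure x y + pure ((- c) \<odot>\<^bsub>A\<^esub> x') y"
    using assms by (intro pure_add_l) auto
  also have "\<dots> \<approx> pure x y + scale (- c) (pure x' y)"
    using assms by (intro cong_add cong_refl pure_smult_l)
  finally show ?thesis using assms by (simp add: A.minus_eq A.smult_neg)
qed

lemma pure_diff_r:
  assumes "x \<in> carrier A" "y \<in> carrier B" "y' \<in> carrier B"
  shows "pure x (y \<ominus>\<^bsub>B\<^esub> c \<odot>\<^bsub>B\<^esub> y') \<approx> pure x y - scale c (pure x y')"
proof -
  have "pure x (y \<oplus>\<^bsub>B\<^esub> (- c) \<odot>\<^bsub>B\<^esub> y') \<approx> pure x y + pure x ((- c) \<odot>\<^bsub>B\<^esub> y')"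
    using assms by (intro pure_add_r) auto
  also have "\<dots> \<approx> pure x y + scale (- c) (pure x y')"
    using assms by (intro cong_add cong_refl pure_smult_r)
  finally show ?thesis using assms by (simp add: B.minus_eq B.smult_neg)
qed

text \<open>
  With root vectors in place of tensors, this is the recursion that defines the nonsimple root vectors.
\<close>

definition qcomm :: "complex \<Rightarrow> ('a \<times> 'b \<Rightarrow>\<^sub>0 complex) \<Rightarrow> ('a \<times> 'b \<Rightarrow>\<^sub>0 complex) \<Rightarrow> ('a \<times> 'b \<Rightarrow>\<^sub>0 complex)"
  where "qcomm c v w = pmult v w - scale c (pmult w v)"

lemma qcomm_bilinear:
  "qcomm c (v + v') w = qcomm c v w + qcomm c v' w"
  "qcomm c v (w + w') = qcomm c v w + qcomm c v w'"
  "qcomm c (v - v') w = qcomm c v w - qcomm c v' w"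
  "qcomm c (scale d v) w = scale d (qcomm c v w)"
  "qcomm c (sum f S) w = (\<Sum>i\<in>S. qcomm c (f i) w)"
  by (simp_all add: qcomm_def pmult_add_l pmult_add_r pmult_diff_l pmult_diff_r pmult_scale_l pmult_scale_r
      pmult_sum_l pmult_sum_r formal.scale_right_distrib formal.scale_right_diff_distrib formal.scale_sum_right
      sum_subtractf mult.commute)

lemma cls_qcomm:
  assumes "v \<in> Pre" "w \<in> Pre"
  shows "cls v \<otimes>\<^bsub>T\<^esub> cls w \<oplus>\<^bsub>T\<^esub> (- c) \<odot>\<^bsub>T\<^esub> (cls w \<otimes>\<^bsub>T\<^esub> cls v) = cls (qcomm c v w)"
  using assms by (simp add: cls_mult cls_smult cls_add qcomm_def)

end

section \<open>Free superalgebras and homogeneous quotients\<close>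

lemma mult_scale_l:
  fixes x y :: "'g list \<Rightarrow>\<^sub>0 complex"
  shows "scale c x * y = scale c (x * y)"
  by (simp add: scale_def mult_map_scale_conv_mult mult.assoc)

lemma mult_scale_r:
  fixes x y :: "'g list \<Rightarrow>\<^sub>0 complex"
  shows "x * scale c y = scale c (x * y)"
proof -
  have "Poly_Mapping.single k a * scale c y = scale c (Poly_Mapping.single k a * y)" for k :: "'g list" and a
    by (subst (1 2) sum_single_lookup[of y])
      (simp add: sum_distrib_left formal.scale_sum_right scale_single mult_single mult_ac)
  then show ?thesis
    by (subst (1 2) sum_single_lookup[of x])
      (simp add: sum_distrib_right formal.scale_sum_right scale_single)
qed

lemma free_superalgebra: "superalgebra (free_superalg G par)"
proof -
  interpret ring "free_superalg G par" by (rule free_ring)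
  have disj: "x = 0" if "Poly_Mapping.keys x \<subseteq> {w \<in> lists G. sum_list (map par w) = 0}"
    "Poly_Mapping.keys x \<subseteq> {w \<in> lists G. sum_list (map par w) = 1}" for x :: "'a list \<Rightarrow>\<^sub>0 complex"
  proof -
    have "k \<notin> Poly_Mapping.keys x" for k using that[THEN subsetD, of k] by auto
    then have "Poly_Mapping.keys x = {}" by blast
    then show ?thesis by simp
  qed
  have dec: "\<exists>y. Poly_Mapping.keys y \<subseteq> {w \<in> lists G. sum_list (map par w) = 0} \<and>
      (\<exists>z. Poly_Mapping.keys z \<subseteq> {w \<in> lists G. sum_list (map par w) = 1} \<and> x = y + z)"
    if x: "Poly_Mapping.keys x \<subseteq> lists G" for x :: "'a list \<Rightarrow>\<^sub>0 complex"
  proof -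
    define part where "part S = (\<Sum>k\<in>S. scale (Poly_Mapping.lookup x k) (Poly_Mapping.single k 1))" for S
    have keys: "Poly_Mapping.keys (part S) \<subseteq> S" if "finite S" for S
      unfolding part_def scale_single by (rule order_trans[OF keys_sum]) (auto split: if_splits)
    let ?E = "{w. sum_list (map par w) = 0}"
    let ?K = "Poly_Mapping.keys x"
    have "x = part (?K \<inter> ?E) + part (?K - ?E)"
      by (subst sum_single_lookup[of x]) (simp add: part_def sum.Int_Diff[of ?K _ ?E])
    moreover have "Poly_Mapping.keys (part (?K \<inter> ?E)) \<subseteq> {w \<in> lists G. sum_list (map par w) = 0}"
      using keys[of "?K \<inter> ?E"] x by auto
    moreover have "Poly_Mapping.keys (part (?K - ?E)) \<subseteq> {w \<in> lists G. sum_list (map par w) = 1}"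
      using keys[of "?K - ?E"] x by auto
    ultimately show ?thesis by blast
  qed
  have mul: "Poly_Mapping.keys (x * y) \<subseteq> {w \<in> lists G. sum_list (map par w) = d + e}"
    if "Poly_Mapping.keys x \<subseteq> {w \<in> lists G. sum_list (map par w) = d}"
      "Poly_Mapping.keys y \<subseteq> {w \<in> lists G. sum_list (map par w) = e}" for x y :: "'a list \<Rightarrow>\<^sub>0 complex" and d e
    using keys_mult[of x y] that by (fastforce simp: plus_list_def)
  show ?thesis
  proof (unfold_locales, goal_cases)
    case (11 x d y e)
    then show ?case using mul[of x d y e] by (simp add: free_superalg_def)
  next
    case (12 x)
    then show ?case using dec[of x] by (auto simp: free_superalg_def)
  next
    case (13 x)
    then show ?case using disj[of x] by (simp add: free_superalg_def)
  qed (auto simp: free_superalg_def formal.scale_right_distrib formal.scale_left_distrib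
      mult_scale_l mult_scale_r dest!: set_mp[OF keys_add] set_mp[OF keys_scale])
qed

context superalgebra
begin

definition graded_ideal :: "'a set \<Rightarrow> bool"
  where "graded_ideal I \<longleftrightarrow> ideal I A \<and> (\<forall>x\<in>I. \<exists>y\<in>I \<inter> homog A 0. \<exists>z\<in>I \<inter> homog A 1. x = y \<oplus> z)"

text \<open>
  The sums \<open>y \<oplus> z\<close> of an even and an odd element of the ideal form an ideal
  themselves. It contains every homogeneous generator, hence it is everything.
\<close>

lemma genideal_graded:
  assumes X: "X \<subseteq> homog A 0 \<union> homog A 1"
  shows "graded_ideal (Idl X)"
proof -
  have XA: "X \<subseteq> carrier A" using X homog_carrier by blast
  interpret I: ideal "Idl X" A by (rule genideal_ideal[OF XA])
  define J where "J = {y \<oplus> z | y z. y \<in> Idl X \<inter> homog A 0 \<and> z \<in> Idl X \<inter> homog A 1}"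
  have Jc: "x \<in> carrier A" if "x \<in> J" for x using that by (auto simp: J_def)
  have JI: "y \<oplus> z \<in> J" if "y \<in> Idl X" "z \<in> Idl X" "y \<in> homog A 0" "z \<in> homog A 1" for y z
    using that by (auto simp: J_def)
  have add: "x \<oplus> y \<in> J" if x: "x \<in> J" and y: "y \<in> J" for x y
  proof -
    obtain x0 x1 where x: "x = x0 \<oplus> x1" "x0 \<in> Idl X" "x1 \<in> Idl X" "x0 \<in> homog A 0" "x1 \<in> homog A 1"
      using x by (auto simp: J_def)
    obtain y0 y1 where y: "y = y0 \<oplus> y1" "y0 \<in> Idl X" "y1 \<in> Idl X" "y0 \<in> homog A 0" "y1 \<in> homog A 1"
      using y by (auto simp: J_def)
    have "x \<oplus> y = (x0 \<oplus> y0) \<oplus> (x1 \<oplus> y1)"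
      unfolding x(1) y(1) using x y by (simp add: homog_carrier a_ac)
    then show ?thesis using x y by (auto intro!: JI homog_add)
  qed
  have mul: "y \<otimes> x \<in> J \<and> x \<otimes> y \<in> J" if x: "x \<in> J" and y: "y \<in> carrier A" for x y
  proof -
    obtain x0 x1 where x: "x = x0 \<oplus> x1" "x0 \<in> Idl X" "x1 \<in> Idl X" "x0 \<in> homog A 0" "x1 \<in> homog A 1"
      using x by (auto simp: J_def)
    obtain y0 y1 where y: "y = y0 \<oplus> y1" "y0 \<in> homog A 0" "y1 \<in> homog A 1"
      using homog_decomp[OF y] by auto
    note c = x(4,5)[THEN homog_carrier] y(2,3)[THEN homog_carrier]
    have h: "u \<otimes> v \<in> homog A (d + e)" if "u \<in> homog A d" "v \<in> homog A e" for u v d e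
      using that by (rule homog_mult)
    have "y \<otimes> x = (y0 \<otimes> x0 \<oplus> y1 \<otimes> x1) \<oplus> (y0 \<otimes> x1 \<oplus> y1 \<otimes> x0)"
      unfolding x(1) y(1) using c by (simp add: l_distr r_distr a_ac)
    moreover have "x \<otimes> y = (x0 \<otimes> y0 \<oplus> x1 \<otimes> y1) \<oplus> (x1 \<otimes> y0 \<oplus> x0 \<otimes> y1)"
      unfolding x(1) y(1) using c by (simp add: l_distr r_distr a_ac)
    ultimately show ?thesis
      using x y c h[of x0 0 y0 0] h[of x1 1 y1 1] h[of x0 0 y1 1] h[of x1 1 y0 0]
        h[of y0 0 x0 0] h[of y1 1 x1 1] h[of y1 1 x0 0] h[of y0 0 x1 1]
      by (simp add: JI homog_add I.a_closed I.I_l_closed I.I_r_closed)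
  qed
  have zero: "\<zero> \<in> J" using JI[of \<zero> \<zero>] homog_zero by simp
  have inv: "\<ominus> x \<in> J" if "x \<in> J" for x
    using mul[OF that, of "\<ominus> \<one>"] Jc[OF that] by (simp add: l_minus)
  have "ideal J A"
  proof (rule idealI)
    show "ring A" by (rule ring_axioms)
    show "subgroup J (add_monoid A)"
      by (rule subgroup.intro) (use Jc add zero inv in \<open>auto simp: a_inv_def[symmetric]\<close>)
  qed (use mul in auto)
  moreover have "X \<subseteq> J"
  proof
    fix x assume x: "x \<in> X"
    then have i: "x \<in> Idl X" using genideal_self[OF XA] by blast
    then have "x \<in> carrier A" by simp
    then show "x \<in> J"
      using X x i JI[of x \<zero>] JI[of \<zero> x] homog_zero by auto
  qed
  ultimately have "Idl X \<subseteq> J" by (rule genideal_minimal)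
  then show ?thesis unfolding graded_ideal_def J_def using I.ideal_axioms by blast
qed

text \<open>
  Gradedness of the ideal is what keeps the sum of the two homogeneous parts direct: if an even and
  an odd element are congruent modulo \<^term>\<open>I\<close>, each of them lies in
  \<^term>\<open>I\<close>.
\<close>

lemma quot_superalgebra:
  assumes "graded_ideal I"
  shows "superalgebra (quot_superalg A I)"
proof -
  interpret I: ideal I A using assms by (simp add: graded_ideal_def)
  let ?Q = "quot_superalg A I"
  let ?p = "\<lambda>x. I +> x"
  have car: "carrier ?Q = ?p ` carrier A"
    by (auto simp: quot_superalg_def FactRing_def A_RCOSETS_def')
  have eq: "?p x = ?p y \<longleftrightarrow> x \<ominus> y \<in> I" if "x \<in> carrier A" "y \<in> carrier A" for x y
    using quotient_eq_iff_same_a_r_cos[OF I.ideal_axioms that] by simp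
  have add: "?p x \<oplus>\<^bsub>?Q\<^esub> ?p y = ?p (x \<oplus> y)" if "x \<in> carrier A" "y \<in> carrier A" for x y
    using I.a_rcos_sum[OF that] by (simp add: quot_superalg_def FactRing_def)
  have mul: "?p x \<otimes>\<^bsub>?Q\<^esub> ?p y = ?p (x \<otimes> y)" if "x \<in> carrier A" "y \<in> carrier A" for x y
    using I.rcoset_mult_add[OF that] by (simp add: quot_superalg_def FactRing_def)
  have I_smult: "c \<odot> x \<in> I" if "x \<in> I" for c x
    using that I.I_l_closed[of x "c \<odot> \<one>"] by (simp add: smult_mult_l)
  have self: "x \<in> ?p x" if "x \<in> carrier A" for x using that by (rule I.a_rcos_self)
  have smu: "c \<odot>\<^bsub>?Q\<^esub> ?p x = ?p (c \<odot> x)" if x: "x \<in> carrier A" for c x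
  proof -
    have "?p (c \<odot> y) = ?p (c \<odot> x)" if "y \<in> ?p x" for y
    proof -
      from that obtain i where i: "i \<in> I" "y = i \<oplus> x" by (auto simp: a_r_coset_def')
      have "c \<odot> y \<ominus> c \<odot> x = c \<odot> i"
        unfolding i(2) using i(1) x by (simp add: smult_r_distr minus_eq a_assoc r_neg)
      then show ?thesis using i x I_smult by (subst eq) auto
    qed
    then have "(\<Union>y\<in>?p x. ?p (c \<odot> y)) = ?p (c \<odot> x)"
      by (intro UN_constant_eq[OF self[OF x]]) blast
    then show ?thesis by (simp add: quot_superalg_def)
  qed
  have one: "\<one>\<^bsub>?Q\<^esub> = ?p \<one>" by (simp add: quot_superalg_def FactRing_def)
  have zero: "\<zero>\<^bsub>?Q\<^esub> = ?p \<zero>" using I.a_rcos_const[OF I.zero_closed] by (simp add: quot_superalg_def FactRing_def)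
  have hom: "homog ?Q d = ?p ` homog A d" for d by (simp add: quot_superalg_def)
  have gr: "abelian_group ?Q"
  proof (rule abelian_groupI, goal_cases)
    case (6 x)
    then obtain y where "y \<in> carrier A" "x = ?p y" by (auto simp: car)
    then show ?case by (intro bexI[of _ "?p (\<ominus> y)"]) (auto simp: add zero car l_neg)
  qed (auto simp: car add zero a_ac)
  have mo: "Group.monoid ?Q"
    by (rule monoidI) (auto simp: car mul one m_assoc)
  interpret Q: ring ?Q
    by (rule ringI[OF gr mo]) (auto simp: car add mul l_distr r_distr)
  show ?thesis
  proof (unfold_locales, goal_cases)
    case (13 x)
    then obtain g h where g: "g \<in> homog A 0" "x = ?p g" and h: "h \<in> homog A 1" "x = ?p h"
      by (auto simp: hom)
    note c = g(1)[THEN homog_carrier] h(1)[THEN homog_carrier]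
    have "g \<ominus> h \<in> I" using g h eq[OF c] by simp
    then obtain y z where y: "y \<in> I" "y \<in> homog A 0" and z: "z \<in> I" "z \<in> homog A 1" "g \<ominus> h = y \<oplus> z"
      using assms unfolding graded_ideal_def by blast
    note d = y(2)[THEN homog_carrier] z(2)[THEN homog_carrier]
    have "homog_comp A 0 (g \<oplus> (- 1) \<odot> h) = homog_comp A 0 (y \<oplus> z)"
      using z(3) c by (simp add: minus_eq smult_minus_one)
    then have "g = y"
      using homog_comp_eqI[OF g(1) _ refl, of "(- 1) \<odot> h"] homog_comp_eqI[OF y(2) _ refl, of z]
        homog_smult[OF h(1)] z(2) by simp
    then show ?case using y g c by (simp add: zero eq minus_eq)
  next
    case (12 x)
    then obtain y where y: "y \<in> carrier A" "x = ?p y" by (auto simp: car)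
    obtain y0 y1 where "y0 \<in> homog A 0" "y1 \<in> homog A 1" "y = y0 \<oplus> y1" using homog_decomp[OF y(1)] by blast
    then show ?case using y by (auto simp: hom add homog_carrier intro!: bexI)
  next
    case (11 x d y e)
    then obtain g h where g: "g \<in> homog A d" "x = ?p g" and h: "h \<in> homog A e" "y = ?p h"
      by (auto simp: hom)
    then have "x \<otimes>\<^bsub>?Q\<^esub> y = ?p (g \<otimes> h)" by (simp add: mul homog_carrier)
    then show ?case unfolding hom using homog_mult[OF g(1) h(1)] by blast
  next
    case (9 x d y)
    then show ?case using homog_add by (auto simp: hom add homog_carrier)
  next
    case (10 x d c)
    then show ?case using homog_smult by (auto simp: hom smu homog_carrier)
  qed (auto simp: car hom add mul smu smult_r_distr smult_l_distr smult_smult smult_mult_l smult_mult_r homog_carrier)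
qed

end

section \<open>The quantum superalgebra\<close>

lemma fgen_homog: "g \<in> gens m n P \<Longrightarrow> gen_parity m g = d \<Longrightarrow> fgen g \<in> homog (Uq_free m n P) d"
  by (simp add: Uq_free_def free_superalg_def fgen_def)

context
  fixes m n :: nat and P :: "real set" and q :: complex and qp :: "real \<Rightarrow> complex"
  assumes mn: "0 < m" "0 < n" and qp: "q_powers q P qp"
begin

interpretation F: superalgebra "Uq_free m n P"
  unfolding Uq_free_def by (rule free_superalgebra)

lemma F_homog_closed:
  "x \<in> homog (Uq_free m n P) d \<Longrightarrow> y \<in> homog (Uq_free m n P) d \<Longrightarrow> x + y \<in> homog (Uq_free m n P) d"
  "x \<in> homog (Uq_free m n P) d \<Longrightarrow> y \<in> homog (Uq_free m n P) d \<Longrightarrow> x - y \<in> homog (Uq_free m n P) d"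
  "x \<in> homog (Uq_free m n P) d \<Longrightarrow> scale c x \<in> homog (Uq_free m n P) d"
  "x \<in> homog (Uq_free m n P) d \<Longrightarrow> y \<in> homog (Uq_free m n P) e \<Longrightarrow> d + e = f \<Longrightarrow> x * y \<in> homog (Uq_free m n P) f"
  "0 \<in> homog (Uq_free m n P) d" "1 \<in> homog (Uq_free m n P) 0"
proof -
  note s = Uq_free_simps[OF mn qp]
  show a: "x \<in> homog (Uq_free m n P) d \<Longrightarrow> y \<in> homog (Uq_free m n P) d \<Longrightarrow> x + y \<in> homog (Uq_free m n P) d" for x y d
    using F.homog_add[of x d y] by (simp add: s)
  show b: "x \<in> homog (Uq_free m n P) d \<Longrightarrow> scale c x \<in> homog (Uq_free m n P) d" for x c d
    using F.homog_smult[of x d c] by (simp add: s)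
  show "x \<in> homog (Uq_free m n P) d \<Longrightarrow> y \<in> homog (Uq_free m n P) d \<Longrightarrow> x - y \<in> homog (Uq_free m n P) d"
    using a[of x d "scale (- 1) y"] b[of y d "- 1"] by (simp add: formal.scale_minus_left)
  show "x \<in> homog (Uq_free m n P) d \<Longrightarrow> y \<in> homog (Uq_free m n P) e \<Longrightarrow> d + e = f \<Longrightarrow> x * y \<in> homog (Uq_free m n P) f"
    using F.homog_mult[of x d y e] by (simp add: s)
  show "0 \<in> homog (Uq_free m n P) d" using F.homog_zero by (simp add: s)
  show "1 \<in> homog (Uq_free m n P) 0" by (simp add: Uq_free_def free_superalg_def zero_list_def)
qed

lemma free_E_homog:
  "a \<in> {1..m+n} \<Longrightarrow> b \<in> {1..m+n} \<Longrightarrow> free_E m qp a b \<in> homog (Uq_free m n P) (idx_parity m a + idx_parity m b)"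
proof (induction "(a - b) + (b - a)" arbitrary: a b rule: less_induct)
  case less
  have *: "free_E m qp a' b' \<in> homog (Uq_free m n P) (idx_parity m a' + idx_parity m b')"
    if "(a' - b') + (b' - a') < (a - b) + (b - a)" "a' \<in> {1..m+n}" "b' \<in> {1..m+n}" for a' b'
    using less.hyps that by blast
  have par: "(x + y) + (y + z) = x + z" "(y + z) + (x + y) = x + z" for x y z :: bit
    by (cases x; cases y; cases z; simp)+
  show ?case
    unfolding free_E.simps[of m qp a b] Let_def
    by (intro if_memI[OF mn qp] F_homog_closed(2,3,5) F_homog_closed(4)[OF * * par(1)] F_homog_closed(4)[OF * * par(2)] fgen_homog)
      (use less.prems in \<open>simp_all add: gens_def image_iff add.commute\<close>)
qed

text \<open>
  Most relations only reorder letters or consist of even ones. In the relation for \<open>[E\<^sup>a\<^sub>a\<^sub>+\<^sub>1, E\<^sup>a\<^sup>+\<^sup>1\<^sub>a]\<close>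
  the two factors have equal parity, so the left side is even, just as the Cartan elements on the right.
\<close>

lemma Uq_relators_homog: "Uq_relators m n P qp \<subseteq> homog (Uq_free m n P) 0 \<union> homog (Uq_free m n P) 1"
proof
  fix x assume x: "x \<in> Uq_relators m n P qp"
  note q = qpow_closed[OF qp]
  have K: "fgen (Cartan a N) \<in> homog (Uq_free m n P) 0" if "a \<in> {1..m+n}" "N \<in> P" for a N
    by (rule fgen_homog) (use that in \<open>auto simp: gens_def\<close>)
  have L: "fgen (Lower a) \<in> homog (Uq_free m n P) (gen_parity m (Lower a))"
    and R: "fgen (Raise a) \<in> homog (Uq_free m n P) (gen_parity m (Raise a))" if "a \<in> {1..<m+n}" for a
    by (rule fgen_homog; use that in \<open>auto simp: gens_def\<close>)+
  have M: "m \<in> {1..<m+n}" using mn by auto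
  \<comment> \<open>Stated with \<open>0 + 0\<close>, the parity of a product of two Cartan elements.\<close>
  have par: "a = b \<Longrightarrow> 0 + 0 = gen_parity m (Raise a) + gen_parity m (Lower b)" for a b by (simp add: idx_parity_def)
  have I: "m + 2 \<in> {1..m+n}" "m - 1 \<in> {1..m+n}" if "2 \<le> m \<and> 2 \<le> n" using that by auto
  have J: "a + 1 \<in> {1..m+n}" "a \<in> {1..m+n}" if "a \<in> {1..<m+n}" for a using that by auto
  have "\<exists>d. x \<in> homog (Uq_free m n P) d"
    using x
    unfolding Uq_relators_def Let_def gcomm_def
    \<comment> \<open>One goal for each family of relations; in each of them the parity is read off from the first monomial.\<close>
    apply (elim UnE)
    subgoal by (elim CollectE exE conjE; hypsubst; rule exI; ((assumption | rule F_homog_closed K L R M q J refl | simp (no_asm) only: ac_simps add_0)+))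
    subgoal by (elim CollectE exE conjE; hypsubst; rule exI; ((assumption | rule F_homog_closed K L R M q J refl | simp (no_asm) only: ac_simps add_0)+))
    subgoal by (elim CollectE exE conjE; hypsubst; rule exI; ((assumption | rule F_homog_closed K L R M q J refl | simp (no_asm) only: ac_simps add_0)+))
    subgoal by (elim CollectE exE conjE; hypsubst; rule exI; ((assumption | rule F_homog_closed K L R M q J refl | simp (no_asm) only: ac_simps add_0)+))
    subgoal by (elim CollectE exE conjE; hypsubst; rule exI; ((assumption | rule F_homog_closed K L R M q J refl | simp (no_asm) only: ac_simps add_0)+))
    subgoal by (elim CollectE exE conjE; hypsubst; rule exI; ((assumption | rule F_homog_closed if_memI[OF mn qp] K L R M q J refl | erule par | simp (no_asm) only: ac_simps add_0)+))
    subgoal by (elim CollectE exE conjE; hypsubst; rule exI; ((assumption | rule F_homog_closed K L R M q J refl | simp (no_asm) only: ac_simps add_0)+))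
    subgoal by (elim CollectE exE conjE; hypsubst; rule exI; ((assumption | rule F_homog_closed K L R M q J refl | simp (no_asm) only: ac_simps add_0)+))
    subgoal by (elim insertE emptyE; hypsubst; rule exI; ((assumption | rule F_homog_closed K L R M q J refl | simp (no_asm) only: ac_simps add_0)+))
    subgoal by (elim CollectE exE conjE; hypsubst; rule exI; ((assumption | rule F_homog_closed K L R M q J refl | simp (no_asm) only: ac_simps add_0)+))
    subgoal by (elim CollectE exE conjE; hypsubst; rule exI; ((assumption | rule F_homog_closed K L R M q J refl | simp (no_asm) only: ac_simps add_0)+))
    subgoal
      apply (split if_split_asm)
      subgoal by (elim insertE emptyE; hypsubst; rule exI; ((assumption | assumption | rule F_homog_closed L R M free_E_homog I refl | simp (no_asm) only: ac_simps)+))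
      subgoal by simp
      done
    done
  then obtain d where "x \<in> homog (Uq_free m n P) d" by blast
  then show "x \<in> homog (Uq_free m n P) 0 \<union> homog (Uq_free m n P) 1" by (cases d) auto
qed

lemma Uq_superalgebra: "superalgebra (Uq m n P qp)"
  unfolding Uq_def Uq_ideal_def
  by (rule F.quot_superalgebra[OF F.genideal_graded[OF Uq_relators_homog]])

end

section \<open>Commutation relations of root vectors\<close>

text \<open>
  Induction on the distance of two distinct indices, in both directions at once, where the pair is
  split at the neighbour of its second member.
\<close>

lemma index_pair_induct [consumes 3, case_names adjacent split]:
  fixes a b N :: nat
  assumes "a \<in> {1..N}" "b \<in> {1..N}" "a \<noteq> b"
    and adj: "\<And>a b. a \<in> {1..N} \<Longrightarrow> b \<in> {1..N} \<Longrightarrow> a = b + 1 \<or> b = a + 1 \<Longrightarrow> Q a b"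
    and split: "\<And>a c b. a \<in> {1..N} \<Longrightarrow> b \<in> {1..N} \<Longrightarrow> c \<in> {1..N} \<Longrightarrow> c \<in> {min a b<..<max a b} \<Longrightarrow>
      c = b + 1 \<or> b = c + 1 \<Longrightarrow> Q a c \<Longrightarrow> Q c b \<Longrightarrow> Q a b"
  shows "Q a b"
  using assms(1-3)
proof (induction "(a - b) + (b - a)" arbitrary: a b rule: less_induct)
  case less
  show ?case
  proof (cases "a = b + 1 \<or> b = a + 1")
    case True
    then show ?thesis using adj less.prems by blast
  next
    case False
    define c where "c = (if b < a then b + 1 else b - 1)"
    have c: "c \<in> {1..N}" "c \<in> {min a b<..<max a b}" "c = b + 1 \<or> b = c + 1" "a \<noteq> c"
      using False less.prems unfolding c_def by (auto split: if_splits)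
    show ?thesis
    proof (rule split[of a b c])
      show "Q a c" using c less.prems by (intro less.hyps) auto
      show "Q c b" using c less.prems by (intro adj) auto
    qed (use c less.prems in auto)
  qed
qed

locale quantum_gl =
  fixes m n :: nat and P :: "real set" and q :: complex and qp :: "real \<Rightarrow> complex"
  assumes mn: "0 < m" "0 < n" and qp: "q_powers q P qp" and q0: "q \<noteq> 0"
begin

abbreviation "U \<equiv> Uq m n P qp"
abbreviation "K \<equiv> Uq_K m n P qp"
abbreviation "E \<equiv> Uq_E m n P qp"
abbreviation "Ix \<equiv> {1..m + n}"

sublocale U: superalgebra U by (rule Uq_superalgebra[OF mn qp])

lemmas P_closed = qpow_closed[OF qp]

lemma qp_add: "M \<in> P \<Longrightarrow> N \<in> P \<Longrightarrow> qp (M + N) = qp M * qp N"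
  using qp by (auto simp: q_powers_def)

lemma qp_zero: "qp 0 = 1"
  using qp_add[of 1 0] P_closed q0 qp by (simp add: q_powers_def)

lemma qa_add: "M \<in> P \<Longrightarrow> N \<in> P \<Longrightarrow> qa m qp x (M + N) = qa m qp x M * qa m qp x N"
  using qp_add[of M N] qp_add[of "- M" "- N"] P_closed(6) by (auto simp: qa_def)

lemma qa_zero: "qa m qp x 0 = 1"
  by (simp add: qa_def qp_zero)

lemma Uq_coset_homog:
  "x \<in> homog (Uq_free m n P) d \<Longrightarrow> Uq_ideal m n P qp +>\<^bsub>Uq_free m n P\<^esub> x \<in> homog U d"
  by (simp add: Uq_def quot_superalg_def)

lemma K_homog: "a \<in> Ix \<Longrightarrow> N \<in> P \<Longrightarrow> K a N \<in> homog U 0"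
  unfolding Uq_K_def by (intro Uq_coset_homog fgen_homog) (auto simp: gens_def)

lemma E_homog: "a \<in> Ix \<Longrightarrow> b \<in> Ix \<Longrightarrow> E a b \<in> homog U (idx_parity m a + idx_parity m b)"
  unfolding Uq_E_def by (intro Uq_coset_homog free_E_homog[OF mn qp])

lemma K_closed [simp]: "a \<in> Ix \<Longrightarrow> N \<in> P \<Longrightarrow> K a N \<in> carrier U"
  using K_homog U.homog_carrier by blast

lemma E_closed [simp]: "a \<in> Ix \<Longrightarrow> b \<in> Ix \<Longrightarrow> E a b \<in> carrier U"
  using E_homog U.homog_carrier by blast

lemma Cartan_carrier: "a \<in> Ix \<Longrightarrow> N \<in> P \<Longrightarrow> fgen (Cartan a N) \<in> carrier (Uq_free m n P)"
  by (rule Uq_free_closed[OF mn qp]) (auto simp: gens_def)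

lemma simple_carrier: "a \<in> {1..<m+n} \<Longrightarrow> fgen (Lower a) \<in> carrier (Uq_free m n P)"
  "a \<in> {1..<m+n} \<Longrightarrow> fgen (Raise a) \<in> carrier (Uq_free m n P)"
  by (rule Uq_free_closed[OF mn qp]; auto simp: gens_def)+

lemmas coset_mult = Uq_coset_mult[OF mn qp]
lemmas coset_smult = Uq_coset_smult[OF mn qp]
lemmas coset_eqI = Uq_coset_eqI[OF mn qp]
lemmas free_closed = Uq_free_closed[OF mn qp]
lemmas relators_ideal = Uq_relators_ideal[OF mn qp]

lemma K_zero: "a \<in> Ix \<Longrightarrow> K a 0 = \<one>\<^bsub>U\<^esub>"
  unfolding Uq_K_def Uq_def quot_superalg_def FactRing_def superalg.simps module.simps ring.simps monoid.simps
    Uq_free_simps[OF mn qp]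
  by (rule coset_eqI; intro Cartan_carrier free_closed P_closed relators_ideal)
    (unfold Uq_relators_def Let_def Un_iff, auto)

lemma relation:
  assumes "x - y \<in> Uq_relators m n P qp" "x \<in> carrier (Uq_free m n P)" "y \<in> carrier (Uq_free m n P)"
  shows "Uq_ideal m n P qp +>\<^bsub>Uq_free m n P\<^esub> x = Uq_ideal m n P qp +>\<^bsub>Uq_free m n P\<^esub> y"
  using assms by (intro coset_eqI relators_ideal)

lemma K_mult:
  assumes a: "a \<in> Ix" and N: "M \<in> P" "N \<in> P"
  shows "K a M \<otimes>\<^bsub>U\<^esub> K a N = K a (M + N)"
proof -
  have r: "fgen (Cartan a M) * fgen (Cartan a N) - fgen (Cartan a (M + N)) \<in> Uq_relators m n P qp"
  proof -
    have "fgen (Cartan a M) * fgen (Cartan a N) - fgen (Cartan a (M + N)) \<in>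
      {fgen (Cartan a M) * fgen (Cartan a N) - fgen (Cartan a (M + N)) | a M N. a \<in> Ix \<and> M \<in> P \<and> N \<in> P}"
      by (rule CollectI, intro exI[of _ a] exI[of _ M] exI[of _ N]) (simp only: assms simp_thms)
    then show ?thesis unfolding Uq_relators_def Let_def Un_iff by (simp only: simp_thms)
  qed
  note cl = Cartan_carrier[OF a N(1)] Cartan_carrier[OF a N(2)] Cartan_carrier[OF a P_closed(7)[OF N]]
  show ?thesis
    unfolding Uq_K_def coset_mult[OF cl(1,2)] by (intro relation[OF r] free_closed cl)
qed

lemma K_comm:
  assumes a: "a \<in> Ix" and b: "b \<in> Ix" and N: "M \<in> P" "N \<in> P"
  shows "K a M \<otimes>\<^bsub>U\<^esub> K b N = K b N \<otimes>\<^bsub>U\<^esub> K a M"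
proof -
  have r: "fgen (Cartan a M) * fgen (Cartan b N) - fgen (Cartan b N) * fgen (Cartan a M) \<in> Uq_relators m n P qp"
    unfolding Uq_relators_def Let_def Un_iff using assms by blast
  note cl = Cartan_carrier[OF a N(1)] Cartan_carrier[OF b N(2)]
  show ?thesis
    unfolding Uq_K_def coset_mult[OF cl] coset_mult[OF cl(2,1)] by (intro relation[OF r] free_closed cl)
qed

lemma E_simple:
  "E (b + 1) b = Uq_ideal m n P qp +>\<^bsub>Uq_free m n P\<^esub> fgen (Lower b)"
  "E b (b + 1) = Uq_ideal m n P qp +>\<^bsub>Uq_free m n P\<^esub> fgen (Raise b)"
  unfolding Uq_E_def by (subst free_E.simps; simp)+

lemma K_Lower:
  assumes a: "a \<in> Ix" and b: "b \<in> {1..<m + n}" and N: "N \<in> P"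
  shows "K a N \<otimes>\<^bsub>U\<^esub> E (b + 1) b = qa m qp a (N * (kdelta a (b + 1) - kdelta a b)) \<odot>\<^bsub>U\<^esub> (E (b + 1) b \<otimes>\<^bsub>U\<^esub> K a N)"
proof -
  have r: "fgen (Cartan a N) * fgen (Lower b) - scale (qa m qp a (N * (kdelta a (b + 1) - kdelta a b))) (fgen (Lower b) * fgen (Cartan a N)) \<in> Uq_relators m n P qp"
    unfolding Uq_relators_def Let_def Un_iff using assms by blast
  note cl = Cartan_carrier[OF a N] simple_carrier(1)[OF b]
  show ?thesis
    unfolding Uq_K_def E_simple coset_mult[OF cl] coset_mult[OF cl(2,1)] coset_smult[OF free_closed(5)[OF cl(2,1)]]
    by (intro relation[OF r] free_closed cl)
qed

lemma K_Raise:
  assumes a: "a \<in> Ix" and b: "b \<in> {1..<m + n}" and N: "N \<in> P"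
  shows "K a N \<otimes>\<^bsub>U\<^esub> E b (b + 1) = qa m qp a (N * (kdelta a b - kdelta a (b + 1))) \<odot>\<^bsub>U\<^esub> (E b (b + 1) \<otimes>\<^bsub>U\<^esub> K a N)"
proof -
  have r: "fgen (Cartan a N) * fgen (Raise b) - scale (qa m qp a (N * (kdelta a b - kdelta a (b + 1)))) (fgen (Raise b) * fgen (Cartan a N)) \<in> Uq_relators m n P qp"
    unfolding Uq_relators_def Let_def Un_iff using assms by blast
  note cl = Cartan_carrier[OF a N] simple_carrier(2)[OF b]
  show ?thesis
    unfolding Uq_K_def E_simple coset_mult[OF cl] coset_mult[OF cl(2,1)] coset_smult[OF free_closed(5)[OF cl(2,1)]]
    by (intro relation[OF r] free_closed cl)
qed

text \<open>
  The two recursions for lowering and raising root vectors agree once the exponent of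
  \<open>q\<^sub>c\<close> is written as the sign of \<^term>\<open>a - b\<close>.
\<close>

lemma E_split:
  assumes "a \<in> Ix" "b \<in> Ix" "c \<in> {min a b<..<max a b}"
  shows "E a b = E a c \<otimes>\<^bsub>U\<^esub> E c b \<ominus>\<^bsub>U\<^esub> qa m qp c (sgn (real a - real b)) \<odot>\<^bsub>U\<^esub> (E c b \<otimes>\<^bsub>U\<^esub> E a c)"
proof (cases "b < a")
  case True
  then show ?thesis using Uq_E_lower[OF mn qp, of b c a] assms by simp
next
  case False
  then show ?thesis using Uq_E_raise[OF mn qp, of a c b] assms by simp
qed

text \<open>
  The weights of two factors add up, and both products in the recursion have the same weight.
\<close>

lemma K_E:
  assumes "a \<in> Ix" "b \<in> Ix" "a \<noteq> b" "x \<in> Ix" "N \<in> P"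
  shows "K x N \<otimes>\<^bsub>U\<^esub> E a b = qa m qp x (N * (kdelta x a - kdelta x b)) \<odot>\<^bsub>U\<^esub> (E a b \<otimes>\<^bsub>U\<^esub> K x N)"
  using assms(1-3)
proof (induction rule: index_pair_induct)
  case (adjacent a b)
  then show ?case using K_Lower[of x b N] K_Raise[of x a N] assms by auto
next
  case (split a c b)
  let ?f = "\<lambda>a b. qa m qp x (N * (kdelta x a - kdelta x b))"
  have N: "N * (kdelta x a - kdelta x b) \<in> P" for a b
    using assms(5) P_closed by (auto simp: kdelta_def)
  have "?f a c * ?f c b = qa m qp x (N * (kdelta x a - kdelta x c) + N * (kdelta x c - kdelta x b))"
    by (rule qa_add[symmetric]; rule N)
  then have f: "?f a c * ?f c b = ?f a b" by (simp add: algebra_simps)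
  note cl = split.hyps(1-3) assms(4,5)
  have 1: "K x N \<otimes>\<^bsub>U\<^esub> (E a c \<otimes>\<^bsub>U\<^esub> E c b) = ?f a b \<odot>\<^bsub>U\<^esub> (E a c \<otimes>\<^bsub>U\<^esub> E c b \<otimes>\<^bsub>U\<^esub> K x N)"
  proof -
    have "K x N \<otimes>\<^bsub>U\<^esub> (E a c \<otimes>\<^bsub>U\<^esub> E c b) = (K x N \<otimes>\<^bsub>U\<^esub> E a c) \<otimes>\<^bsub>U\<^esub> E c b"
      using cl by (simp add: U.m_assoc del: atLeastAtMost_iff)
    also have "\<dots> = ?f a c \<odot>\<^bsub>U\<^esub> (E a c \<otimes>\<^bsub>U\<^esub> (K x N \<otimes>\<^bsub>U\<^esub> E c b))"
      unfolding split.IH(1) using cl by (simp add: U.m_assoc U.smult_mult_l del: atLeastAtMost_iff)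
    also have "\<dots> = ?f a b \<odot>\<^bsub>U\<^esub> (E a c \<otimes>\<^bsub>U\<^esub> E c b \<otimes>\<^bsub>U\<^esub> K x N)"
      unfolding split.IH(2) f[symmetric] using cl
      by (simp add: U.m_assoc U.smult_mult_r U.smult_smult del: atLeastAtMost_iff)
    finally show ?thesis .
  qed
  have 2: "K x N \<otimes>\<^bsub>U\<^esub> (E c b \<otimes>\<^bsub>U\<^esub> E a c) = ?f a b \<odot>\<^bsub>U\<^esub> (E c b \<otimes>\<^bsub>U\<^esub> E a c \<otimes>\<^bsub>U\<^esub> K x N)"
  proof -
    have "K x N \<otimes>\<^bsub>U\<^esub> (E c b \<otimes>\<^bsub>U\<^esub> E a c) = (K x N \<otimes>\<^bsub>U\<^esub> E c b) \<otimes>\<^bsub>U\<^esub> E a c"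
      using cl by (simp add: U.m_assoc del: atLeastAtMost_iff)
    also have "\<dots> = ?f c b \<odot>\<^bsub>U\<^esub> (E c b \<otimes>\<^bsub>U\<^esub> (K x N \<otimes>\<^bsub>U\<^esub> E a c))"
      unfolding split.IH(2) using cl by (simp add: U.m_assoc U.smult_mult_l del: atLeastAtMost_iff)
    also have "\<dots> = ?f a b \<odot>\<^bsub>U\<^esub> (E c b \<otimes>\<^bsub>U\<^esub> E a c \<otimes>\<^bsub>U\<^esub> K x N)"
      unfolding split.IH(1) f[symmetric] using cl
      by (simp add: U.m_assoc U.smult_mult_r U.smult_smult mult.commute del: atLeastAtMost_iff)
    finally show ?thesis .
  qed
  show ?case
    unfolding E_split[OF split.hyps(1,2,4)] using cl
    by (simp add: U.minus_eq U.r_distr U.l_distr U.smult_neg[symmetric] U.smult_mult_l U.smult_mult_r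
        U.smult_r_distr U.smult_smult 1 2 mult.commute del: atLeastAtMost_iff)
qed

text \<open>
  The simple generators from which \<^term>\<open>E a d\<close> is built are all at distance at
  least two from \<^term>\<open>E c b\<close>, since \<^term>\<open>d\<close> and
  \<^term>\<open>c\<close> are different.
\<close>

lemma E_far_comm:
  assumes "a \<in> Ix" "d \<in> Ix" "a \<noteq> d" "c \<in> Ix" "b \<in> Ix" "c = b + 1 \<or> b = c + 1"
    and "(a < d \<and> d < c \<and> c < b) \<or> (b < c \<and> c < d \<and> d < a)"
  shows "E a d \<otimes>\<^bsub>U\<^esub> E c b = E c b \<otimes>\<^bsub>U\<^esub> E a d"
  using assms(1-3,7)
proof (induction rule: index_pair_induct)
  case (adjacent a d)
  have far: "E (i + 1) i \<otimes>\<^bsub>U\<^esub> E (j + 1) j = E (j + 1) j \<otimes>\<^bsub>U\<^esub> E (i + 1) i"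
    "E i (i + 1) \<otimes>\<^bsub>U\<^esub> E j (j + 1) = E j (j + 1) \<otimes>\<^bsub>U\<^esub> E i (i + 1)"
    if "i \<in> {1..<m + n}" "j \<in> {1..<m + n}" "i + 1 < j \<or> j + 1 < i" for i j
    using coset_eqI[OF _ _ Uq_relators_far(1)[OF mn qp that]] coset_eqI[OF _ _ Uq_relators_far(2)[OF mn qp that]]
      that(1,2) unfolding E_simple
    by (simp_all add: coset_mult simple_carrier free_closed del: atLeastLessThan_iff)
  show ?case using adjacent assms(4-6) far(1)[of d b] far(2)[of a c] by auto
next
  case (split a x d)
  have 1: "E a x \<otimes>\<^bsub>U\<^esub> E c b = E c b \<otimes>\<^bsub>U\<^esub> E a x" by (rule split.IH) (use split in auto)
  have 2: "E x d \<otimes>\<^bsub>U\<^esub> E c b = E c b \<otimes>\<^bsub>U\<^esub> E x d" by (rule split.IH) (use split in auto)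
  note cl = split.hyps(1-3) assms(4,5)
  have comm: "y \<otimes>\<^bsub>U\<^esub> z \<otimes>\<^bsub>U\<^esub> E c b = E c b \<otimes>\<^bsub>U\<^esub> (y \<otimes>\<^bsub>U\<^esub> z)"
    if "y \<otimes>\<^bsub>U\<^esub> E c b = E c b \<otimes>\<^bsub>U\<^esub> y" "z \<otimes>\<^bsub>U\<^esub> E c b = E c b \<otimes>\<^bsub>U\<^esub> z" "y \<in> carrier U" "z \<in> carrier U" for y z
    using that cl by (metis U.m_assoc E_closed)
  show ?case
    unfolding E_split[OF split.hyps(1,2,4)] using cl comm[OF 1 2] comm[OF 2 1]
    by (simp add: U.minus_eq U.r_distr U.l_distr U.smult_neg[symmetric] U.smult_mult_l U.smult_mult_r
        del: atLeastAtMost_iff)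
qed

section \<open>The coproduct of the root vectors\<close>

sublocale superalgebra_pair U U ..

notation cong (infix "\<approx>" 50)

text \<open>
  In the notation of the introduction this is \<open>k\<^sub>x\<^sub>y\<close>; the parameter \<^term>\<open>s\<close> is the sign that distinguishes lowering
  from raising root vectors.
\<close>

definition K_ratio :: "real \<Rightarrow> nat \<Rightarrow> nat \<Rightarrow> (gen list \<Rightarrow>\<^sub>0 complex) set"
  where "K_ratio s x y = K x (s / 2) \<otimes>\<^bsub>U\<^esub> K y (- s / 2)"

definition middle :: "real \<Rightarrow> nat \<Rightarrow> nat \<Rightarrow> nat \<Rightarrow> (gen list \<Rightarrow>\<^sub>0 complex) set \<times> (gen list \<Rightarrow>\<^sub>0 complex) set \<Rightarrow>\<^sub>0 complex"
  where "middle s a b c = pure (K_ratio s b c \<otimes>\<^bsub>U\<^esub> E a c) (E c b \<otimes>\<^bsub>U\<^esub> K_ratio s a c)"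

text \<open>
  A representative, in the free vector space on \<^term>\<open>carrier U \<times> carrier U\<close>, of the claimed value of
  \<open>\<Delta>(E\<^sup>a\<^sub>b)\<close>, where \<^term>\<open>s\<close> is the sign of \<^term>\<open>a - b\<close>.
\<close>

definition coprod_E :: "real \<Rightarrow> nat \<Rightarrow> nat \<Rightarrow> (gen list \<Rightarrow>\<^sub>0 complex) set \<times> (gen list \<Rightarrow>\<^sub>0 complex) set \<Rightarrow>\<^sub>0 complex"
  where "coprod_E s a b = pure (E a b) (K_ratio s a b) + pure (K_ratio s b a) (E a b)
    - scale (of_real s) (\<Sum>c\<in>{min a b<..<max a b}. scale (qa m qp c 1 - qa m qp c (- 1)) (middle s a b c))"

lemma half_exponents:
  assumes "s = 1 \<or> s = - 1"
  shows "s / 2 \<in> P" "- s / 2 \<in> P" "s \<in> P" "- s \<in> P"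
  using assms P_closed by auto

context
  fixes s :: real
  assumes s: "s = 1 \<or> s = - 1"
begin

lemmas sP = half_exponents[OF s]

lemma K_ratio_homog: "x \<in> Ix \<Longrightarrow> y \<in> Ix \<Longrightarrow> K_ratio s x y \<in> homog U 0"
  unfolding K_ratio_def using U.homog_mult[OF K_homog K_homog] sP by fastforce

lemma K_ratio_closed [simp]: "x \<in> Ix \<Longrightarrow> y \<in> Ix \<Longrightarrow> K_ratio s x y \<in> carrier U"
  by (rule U.homog_carrier[OF K_ratio_homog])

lemma K_K_ratio_comm: "x \<in> Ix \<Longrightarrow> y \<in> Ix \<Longrightarrow> z \<in> Ix \<Longrightarrow> N \<in> P \<Longrightarrow> K z N \<otimes>\<^bsub>U\<^esub> K_ratio s x y = K_ratio s x y \<otimes>\<^bsub>U\<^esub> K z N"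
  unfolding K_ratio_def using sP by (metis K_comm K_closed U.m_assoc)

lemma K_ratio_comm: "x \<in> Ix \<Longrightarrow> y \<in> Ix \<Longrightarrow> z \<in> Ix \<Longrightarrow> w \<in> Ix \<Longrightarrow> K_ratio s x y \<otimes>\<^bsub>U\<^esub> K_ratio s z w = K_ratio s z w \<otimes>\<^bsub>U\<^esub> K_ratio s x y"
  using K_K_ratio_comm[of z w x "s / 2"] K_K_ratio_comm[of z w y "- s / 2"] sP
  by (metis K_ratio_def K_closed K_ratio_closed U.m_assoc)

lemma K_ratio_trans:
  assumes "x \<in> Ix" "y \<in> Ix" "z \<in> Ix"
  shows "K_ratio s x y \<otimes>\<^bsub>U\<^esub> K_ratio s y z = K_ratio s x z"
proof -
  have "K_ratio s x y \<otimes>\<^bsub>U\<^esub> K_ratio s y z = K x (s / 2) \<otimes>\<^bsub>U\<^esub> ((K y (- s / 2) \<otimes>\<^bsub>U\<^esub> K y (s / 2)) \<otimes>\<^bsub>U\<^esub> K z (- s / 2))"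
    using assms sP by (simp add: K_ratio_def U.m_assoc del: atLeastAtMost_iff)
  also have "K y (- s / 2) \<otimes>\<^bsub>U\<^esub> K y (s / 2) = \<one>\<^bsub>U\<^esub>"
    using K_mult[OF assms(2) sP(2,1)] K_zero[OF assms(2)] by simp
  finally show ?thesis using assms sP by (simp add: K_ratio_def del: atLeastAtMost_iff)
qed

text \<open>
  Moving a ratio of Cartan elements to the left past a root vector. The factor is the product of two
  weights of opposite exponents.
\<close>

lemma E_K_ratio:
  assumes "x \<in> Ix" "y \<in> Ix" "a \<in> Ix" "b \<in> Ix" "a \<noteq> b"
  shows "E a b \<otimes>\<^bsub>U\<^esub> K_ratio s x y =
    (qa m qp x (s / 2 * (kdelta x b - kdelta x a)) * qa m qp y (- s / 2 * (kdelta y b - kdelta y a))) \<odot>\<^bsub>U\<^esub> (K_ratio s x y \<otimes>\<^bsub>U\<^esub> E a b)"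
proof -
  have KE: "E a b \<otimes>\<^bsub>U\<^esub> K z N = qa m qp z (N * (kdelta z b - kdelta z a)) \<odot>\<^bsub>U\<^esub> (K z N \<otimes>\<^bsub>U\<^esub> E a b)"
    if z: "z \<in> Ix" "N \<in> P" for z N
  proof -
    have D: "N * (kdelta z x - kdelta z y) \<in> P" for x y
      using z(2) P_closed by (auto simp: kdelta_def)
    have "qa m qp z (N * (kdelta z b - kdelta z a)) * qa m qp z (N * (kdelta z a - kdelta z b))
      = qa m qp z (N * (kdelta z b - kdelta z a) + N * (kdelta z a - kdelta z b))"
      by (rule qa_add[symmetric]; rule D)
    also have "\<dots> = 1" by (simp add: algebra_simps qa_zero)
    finally show ?thesis
      unfolding K_E[OF assms(3-5) z] using assms z by (simp add: U.smult_smult del: atLeastAtMost_iff)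
  qed
  have "E a b \<otimes>\<^bsub>U\<^esub> K_ratio s x y = (E a b \<otimes>\<^bsub>U\<^esub> K x (s / 2)) \<otimes>\<^bsub>U\<^esub> K y (- s / 2)"
    using assms sP by (simp add: K_ratio_def U.m_assoc del: atLeastAtMost_iff)
  also have "\<dots> = qa m qp x (s / 2 * (kdelta x b - kdelta x a)) \<odot>\<^bsub>U\<^esub> (K x (s / 2) \<otimes>\<^bsub>U\<^esub> (E a b \<otimes>\<^bsub>U\<^esub> K y (- s / 2)))"
    unfolding KE[OF assms(1) sP(1)] using assms sP by (simp add: U.smult_mult_l U.m_assoc del: atLeastAtMost_iff)
  also have "\<dots> = (qa m qp x (s / 2 * (kdelta x b - kdelta x a)) * qa m qp y (- s / 2 * (kdelta y b - kdelta y a))) \<odot>\<^bsub>U\<^esub> (K_ratio s x y \<otimes>\<^bsub>U\<^esub> E a b)"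
    unfolding KE[OF assms(2) sP(2)] using assms sP
    by (simp add: K_ratio_def U.smult_mult_r U.smult_smult U.m_assoc del: atLeastAtMost_iff)
  finally show ?thesis .
qed

text \<open>
  The parity is monotone in the index and jumps only once, so it cannot change within both of two
  successive intervals.
\<close>

lemma koszul_disjoint:
  assumes "(i \<le> j \<and> j \<le> k \<and> k \<le> l) \<or> (l \<le> k \<and> k \<le> j \<and> j \<le> i)"
  shows "koszul (idx_parity m i + idx_parity m j) (idx_parity m k + idx_parity m l) = 1"
    "koszul (idx_parity m k + idx_parity m l) (idx_parity m i + idx_parity m j) = 1"
  using assms by (auto simp: koszul_def idx_parity_def split: if_splits)

lemma coprod_E_closed: "a \<in> Ix \<Longrightarrow> b \<in> Ix \<Longrightarrow> coprod_E s a b \<in> Pre"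
  unfolding coprod_E_def middle_def by (intro Pre_closed pure_Pre U.m_closed K_ratio_closed E_closed) auto

context
  fixes a b c :: nat
  assumes ab: "a \<in> Ix" "b \<in> Ix" "c \<in> Ix" and c: "c \<in> {min a b<..<max a b}" "c = b + 1 \<or> b = c + 1"
    and s_eq: "s = sgn (real a - real b)"
begin

private abbreviation "r \<equiv> qa m qp c (s / 2)"
private abbreviation "r' \<equiv> qa m qp c (- s / 2)"

lemma distinct_indices: "a \<noteq> b" "a \<noteq> c" "c \<noteq> b" using c by auto

lemma half_weights: "r * r = qa m qp c s" "r' * r' = qa m qp c (- s)" "r * r' = 1"
  using qa_add[OF sP(1,1), of c] qa_add[OF sP(2,2), of c] qa_add[OF sP(1,2), of c] by (simp_all add: qa_zero)

lemma E_ab: "E a b = E a c \<otimes>\<^bsub>U\<^esub> E c b \<ominus>\<^bsub>U\<^esub> qa m qp c s \<odot>\<^bsub>U\<^esub> (E c b \<otimes>\<^bsub>U\<^esub> E a c)"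
  using E_split[OF ab(1,2) c(1)] s_eq by simp

lemma koszul_split: "koszul (idx_parity m a + idx_parity m c) (idx_parity m c + idx_parity m b) = 1"
  "koszul (idx_parity m c + idx_parity m b) (idx_parity m a + idx_parity m c) = 1"
  by (rule koszul_disjoint; use c in auto)+

lemma qcomm_11:
  "qcomm (qa m qp c s) (pure (E a c) (K_ratio s a c)) (pure (E c b) (K_ratio s c b)) \<approx> pure (E a b) (K_ratio s a b)"
proof -
  have 1: "pmult (pure (E a c) (K_ratio s a c)) (pure (E c b) (K_ratio s c b)) \<approx> pure (E a c \<otimes>\<^bsub>U\<^esub> E c b) (K_ratio s a b)"
    using pmult_even[OF E_closed K_ratio_homog E_homog K_ratio_closed, of a c a c c b c b] ab K_ratio_trans[of a c b] by simp
  have 2: "pmult (pure (E c b) (K_ratio s c b)) (pure (E a c) (K_ratio s a c)) \<approx> pure (E c b \<otimes>\<^bsub>U\<^esub> E a c) (K_ratio s a b)"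
    using pmult_even[OF E_closed K_ratio_homog E_homog K_ratio_closed, of c b c b a c a c] ab K_ratio_trans[of a c b]
      K_ratio_comm[of c b a c] by simp
  have "pure (E a b) (K_ratio s a b) \<approx> pure (E a c \<otimes>\<^bsub>U\<^esub> E c b) (K_ratio s a b) - scale (qa m qp c s) (pure (E c b \<otimes>\<^bsub>U\<^esub> E a c) (K_ratio s a b))"
    unfolding E_ab by (rule pure_diff_l) (use ab in auto)
  then show ?thesis
    unfolding qcomm_def using cong_diff[OF 1 cong_scale[OF 2]] cong_trans cong_sym by blast
qed

lemma qcomm_22:
  "qcomm (qa m qp c s) (pure (K_ratio s c a) (E a c)) (pure (K_ratio s b c) (E c b)) \<approx> pure (K_ratio s b a) (E a b)"
proof -
  have 1: "pmult (pure (K_ratio s c a) (E a c)) (pure (K_ratio s b c) (E c b)) \<approx> pure (K_ratio s b a) (E a c \<otimes>\<^bsub>U\<^esub> E c b)"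
    using pmult_even[OF K_ratio_closed E_homog K_ratio_homog E_closed, of c a a c b c c b] ab K_ratio_trans[of b c a]
      K_ratio_comm[of c a b c] by simp
  have 2: "pmult (pure (K_ratio s b c) (E c b)) (pure (K_ratio s c a) (E a c)) \<approx> pure (K_ratio s b a) (E c b \<otimes>\<^bsub>U\<^esub> E a c)"
    using pmult_even[OF K_ratio_closed E_homog K_ratio_homog E_closed, of b c c b c a a c] ab K_ratio_trans[of b c a] by simp
  have "pure (K_ratio s b a) (E a b) \<approx> pure (K_ratio s b a) (E a c \<otimes>\<^bsub>U\<^esub> E c b) - scale (qa m qp c s) (pure (K_ratio s b a) (E c b \<otimes>\<^bsub>U\<^esub> E a c))"
    unfolding E_ab by (rule pure_diff_r) (use ab in auto)
  then show ?thesis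
    unfolding qcomm_def using cong_diff[OF 1 cong_scale[OF 2]] cong_trans cong_sym by blast
qed

text \<open>
  The new summand: in this order both factors have to be interchanged, each at the cost of
  \<open>q\<^sub>c\<^bsup>-s/2\<^esup>\<close>, in the opposite order none.
\<close>

lemma qcomm_12:
  "qcomm (qa m qp c s) (pure (E a c) (K_ratio s a c)) (pure (K_ratio s b c) (E c b)) \<approx>
    scale (qa m qp c (- s) - qa m qp c s) (middle s a b c)"
proof -
  have "E a c \<otimes>\<^bsub>U\<^esub> K_ratio s b c = r' \<odot>\<^bsub>U\<^esub> (K_ratio s b c \<otimes>\<^bsub>U\<^esub> E a c)"
    using E_K_ratio[OF ab(2,3,1,3) distinct_indices(2)] distinct_indices by (simp add: kdelta_def qa_zero)
  moreover have e: "E c b \<otimes>\<^bsub>U\<^esub> K_ratio s a c = r \<odot>\<^bsub>U\<^esub> (K_ratio s a c \<otimes>\<^bsub>U\<^esub> E c b)"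
    using E_K_ratio[OF ab(1,3,3,2) distinct_indices(3)] distinct_indices by (simp add: kdelta_def qa_zero)
  have "K_ratio s a c \<otimes>\<^bsub>U\<^esub> E c b = r' \<odot>\<^bsub>U\<^esub> (E c b \<otimes>\<^bsub>U\<^esub> K_ratio s a c)"
    unfolding e using ab half_weights by (simp add: U.smult_smult mult.commute del: atLeastAtMost_iff)
  ultimately have "pmult (pure (E a c) (K_ratio s a c)) (pure (K_ratio s b c) (E c b)) \<approx>
      pure (r' \<odot>\<^bsub>U\<^esub> (K_ratio s b c \<otimes>\<^bsub>U\<^esub> E a c)) (r' \<odot>\<^bsub>U\<^esub> (E c b \<otimes>\<^bsub>U\<^esub> K_ratio s a c))"
    using pmult_even[OF E_closed K_ratio_homog K_ratio_homog E_closed, of a c a c b c c b] ab by simp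
  also have "\<dots> \<approx> scale (qa m qp c (- s)) (middle s a b c)"
    unfolding middle_def half_weights(2)[symmetric] using ab by (intro pure_smult2) auto
  finally have 1: "pmult (pure (E a c) (K_ratio s a c)) (pure (K_ratio s b c) (E c b)) \<approx> scale (qa m qp c (- s)) (middle s a b c)" .
  have 2: "pmult (pure (K_ratio s b c) (E c b)) (pure (E a c) (K_ratio s a c)) \<approx> middle s a b c"
    unfolding middle_def using pmult_even[OF K_ratio_closed E_homog E_homog K_ratio_closed koszul_split(2), of b c a c] ab by simp
  show ?thesis
    unfolding qcomm_def using cong_diff[OF 1 cong_scale[OF 2, of "qa m qp c s"]]
    by (simp add: formal.scale_left_diff_distrib)
qed

text \<open>
  Interchanging both factors costs \<open>q\<^sub>c\<^bsup>s/2\<^esup>\<close> each, which is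
  precisely the twist of the commutator.
\<close>

lemma qcomm_21:
  "qcomm (qa m qp c s) (pure (K_ratio s c a) (E a c)) (pure (E c b) (K_ratio s c b)) \<approx> 0"
proof -
  have e: "E c b \<otimes>\<^bsub>U\<^esub> K_ratio s c a = r' \<odot>\<^bsub>U\<^esub> (K_ratio s c a \<otimes>\<^bsub>U\<^esub> E c b)"
    using E_K_ratio[OF ab(3,1,3,2) distinct_indices(3)] distinct_indices by (simp add: kdelta_def qa_zero)
  have f: "E a c \<otimes>\<^bsub>U\<^esub> K_ratio s c b = r \<odot>\<^bsub>U\<^esub> (K_ratio s c b \<otimes>\<^bsub>U\<^esub> E a c)"
    using E_K_ratio[OF ab(3,2,1,3) distinct_indices(2)] distinct_indices by (simp add: kdelta_def qa_zero)
  have e': "K_ratio s c a \<otimes>\<^bsub>U\<^esub> E c b = r \<odot>\<^bsub>U\<^esub> (E c b \<otimes>\<^bsub>U\<^esub> K_ratio s c a)"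
    unfolding e using ab half_weights by (simp add: U.smult_smult del: atLeastAtMost_iff)
  have "pmult (pure (K_ratio s c a) (E a c)) (pure (E c b) (K_ratio s c b)) \<approx>
      pure (r \<odot>\<^bsub>U\<^esub> (E c b \<otimes>\<^bsub>U\<^esub> K_ratio s c a)) (r \<odot>\<^bsub>U\<^esub> (K_ratio s c b \<otimes>\<^bsub>U\<^esub> E a c))"
    using pmult_even[OF K_ratio_closed E_homog E_homog K_ratio_closed koszul_split(1), of c a c b] ab unfolding e' f by simp
  also have "\<dots> \<approx> scale (qa m qp c s) (pure (E c b \<otimes>\<^bsub>U\<^esub> K_ratio s c a) (K_ratio s c b \<otimes>\<^bsub>U\<^esub> E a c))" (is "_ \<approx> scale _ ?p")
    unfolding half_weights(1)[symmetric] using ab by (intro pure_smult2) auto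
  finally have 1: "pmult (pure (K_ratio s c a) (E a c)) (pure (E c b) (K_ratio s c b)) \<approx> scale (qa m qp c s) ?p" .
  have 2: "pmult (pure (E c b) (K_ratio s c b)) (pure (K_ratio s c a) (E a c)) \<approx> ?p"
    using pmult_even[OF E_closed K_ratio_homog K_ratio_homog E_closed, of c b c b c a a c] ab by simp
  show ?thesis
    unfolding qcomm_def using cong_diff[OF 1 cong_scale[OF 2, of "qa m qp c s"]] by simp
qed

context
  fixes d assumes d: "d \<in> {min a c<..<max a c}"
begin

lemma index_d: "d \<in> Ix" "d \<noteq> a" "d \<noteq> c" "d \<noteq> b" "c \<in> {min d b<..<max d b}" "sgn (real d - real b) = s"
  using d c ab s_eq by (auto simp: sgn_if split: if_splits)

lemma E_db: "E d b = E d c \<otimes>\<^bsub>U\<^esub> E c b \<ominus>\<^bsub>U\<^esub> qa m qp c s \<odot>\<^bsub>U\<^esub> (E c b \<otimes>\<^bsub>U\<^esub> E d c)"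
  using E_split[OF index_d(1) ab(2) index_d(5)] index_d(6) by simp

lemma homog_dc: "E d c \<otimes>\<^bsub>U\<^esub> K_ratio s a d \<in> homog U (idx_parity m d + idx_parity m c)"
  using U.homog_mult[OF E_homog K_ratio_homog, of d c a d] ab index_d by simp

lemma homog_ad: "K_ratio s c d \<otimes>\<^bsub>U\<^esub> E a d \<in> homog U (idx_parity m a + idx_parity m d)"
  using U.homog_mult[OF K_ratio_homog E_homog, of c d a d] ab index_d by simp

lemma koszul_middle: "koszul (idx_parity m d + idx_parity m c) (idx_parity m c + idx_parity m b) = 1"
  "koszul (idx_parity m c + idx_parity m b) (idx_parity m a + idx_parity m d) = 1"
  by (rule koszul_disjoint; use c d in auto)+

text \<open>
  Again the interchange costs \<open>q\<^sub>c\<^bsup>s/2\<^esup>\<close> in each tensor factor; in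
  the first one the root vectors \<^term>\<open>E a d\<close> and \<^term>\<open>E c b\<close>
  commute.
\<close>

lemma qcomm_middle_1:
  "qcomm (qa m qp c s) (middle s a c d) (pure (E c b) (K_ratio s c b)) \<approx> 0"
proof -
  have e: "E c b \<otimes>\<^bsub>U\<^esub> K_ratio s c d = r' \<odot>\<^bsub>U\<^esub> (K_ratio s c d \<otimes>\<^bsub>U\<^esub> E c b)"
    using E_K_ratio[OF ab(3) index_d(1) ab(3,2) distinct_indices(3)] index_d distinct_indices by (simp add: kdelta_def qa_zero)
  have f: "E d c \<otimes>\<^bsub>U\<^esub> K_ratio s c b = r \<odot>\<^bsub>U\<^esub> (K_ratio s c b \<otimes>\<^bsub>U\<^esub> E d c)"
    using E_K_ratio[OF ab(3,2) index_d(1) ab(3) index_d(3)] index_d distinct_indices by (simp add: kdelta_def qa_zero)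
  have e': "K_ratio s c d \<otimes>\<^bsub>U\<^esub> E c b = r \<odot>\<^bsub>U\<^esub> (E c b \<otimes>\<^bsub>U\<^esub> K_ratio s c d)"
    unfolding e using ab index_d(1) half_weights by (simp add: U.smult_smult del: atLeastAtMost_iff)
  have comm: "E a d \<otimes>\<^bsub>U\<^esub> E c b = E c b \<otimes>\<^bsub>U\<^esub> E a d"
    by (rule E_far_comm) (use ab index_d c d in auto)
  have x: "K_ratio s c d \<otimes>\<^bsub>U\<^esub> E a d \<otimes>\<^bsub>U\<^esub> E c b = r \<odot>\<^bsub>U\<^esub> (E c b \<otimes>\<^bsub>U\<^esub> (K_ratio s c d \<otimes>\<^bsub>U\<^esub> E a d))"
  proof -
    have "K_ratio s c d \<otimes>\<^bsub>U\<^esub> E a d \<otimes>\<^bsub>U\<^esub> E c b = (K_ratio s c d \<otimes>\<^bsub>U\<^esub> E c b) \<otimes>\<^bsub>U\<^esub> E a d"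
      using ab index_d(1) by (simp add: U.m_assoc comm del: atLeastAtMost_iff)
    then show ?thesis unfolding e' using ab index_d(1) by (simp add: U.m_assoc U.smult_mult_l del: atLeastAtMost_iff)
  qed
  have y: "E d c \<otimes>\<^bsub>U\<^esub> K_ratio s a d \<otimes>\<^bsub>U\<^esub> K_ratio s c b = r \<odot>\<^bsub>U\<^esub> (K_ratio s c b \<otimes>\<^bsub>U\<^esub> (E d c \<otimes>\<^bsub>U\<^esub> K_ratio s a d))"
  proof -
    have "E d c \<otimes>\<^bsub>U\<^esub> K_ratio s a d \<otimes>\<^bsub>U\<^esub> K_ratio s c b = (E d c \<otimes>\<^bsub>U\<^esub> K_ratio s c b) \<otimes>\<^bsub>U\<^esub> K_ratio s a d"
      using ab index_d(1) K_ratio_comm[of a d c b] by (simp add: U.m_assoc del: atLeastAtMost_iff)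
    then show ?thesis unfolding f using ab index_d(1) by (simp add: U.m_assoc U.smult_mult_l del: atLeastAtMost_iff)
  qed
  have "pmult (middle s a c d) (pure (E c b) (K_ratio s c b)) \<approx>
      pure (r \<odot>\<^bsub>U\<^esub> (E c b \<otimes>\<^bsub>U\<^esub> (K_ratio s c d \<otimes>\<^bsub>U\<^esub> E a d))) (r \<odot>\<^bsub>U\<^esub> (K_ratio s c b \<otimes>\<^bsub>U\<^esub> (E d c \<otimes>\<^bsub>U\<^esub> K_ratio s a d)))"
    unfolding middle_def x[symmetric] y[symmetric]
    by (rule pmult_even[OF _ homog_dc E_homog _ koszul_middle(1)]) (use ab index_d(1) in auto)
  also have "\<dots> \<approx> scale (qa m qp c s) (pure (E c b \<otimes>\<^bsub>U\<^esub> (K_ratio s c d \<otimes>\<^bsub>U\<^esub> E a d)) (K_ratio s c b \<otimes>\<^bsub>U\<^esub> (E d c \<otimes>\<^bsub>U\<^esub> K_ratio s a d)))"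
    (is "_ \<approx> scale _ ?p")
    unfolding half_weights(1)[symmetric] using ab index_d(1) by (intro pure_smult2) auto
  finally have 1: "pmult (middle s a c d) (pure (E c b) (K_ratio s c b)) \<approx> scale (qa m qp c s) ?p" .
  have 2: "pmult (pure (E c b) (K_ratio s c b)) (middle s a c d) \<approx> ?p"
    unfolding middle_def by (rule pmult_even[OF _ K_ratio_homog homog_ad]) (use ab index_d(1) in auto)
  show ?thesis
    unfolding qcomm_def using cong_diff[OF 1 cong_scale[OF 2, of "qa m qp c s"]] by simp
qed

text \<open>
  The Cartan elements commute with the root vectors that they meet, so the twisted commutator acts
  on the second tensor factor alone and rebuilds \<^term>\<open>E d b\<close> from \<^term>\<open>E
  d c\<close> and \<^term>\<open>E c b\<close>.
\<close>

lemma qcomm_middle_2: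
  "qcomm (qa m qp c s) (middle s a c d) (pure (K_ratio s b c) (E c b)) \<approx> middle s a b d"
proof -
  have e: "K_ratio s b c \<otimes>\<^bsub>U\<^esub> E a d = E a d \<otimes>\<^bsub>U\<^esub> K_ratio s b c"
    using E_K_ratio[OF ab(2,3,1) index_d(1) index_d(2)[symmetric]] ab index_d distinct_indices by (simp add: kdelta_def qa_zero)
  have f: "K_ratio s a d \<otimes>\<^bsub>U\<^esub> E c b = E c b \<otimes>\<^bsub>U\<^esub> K_ratio s a d"
    using E_K_ratio[OF ab(1) index_d(1) ab(3,2) distinct_indices(3)] ab index_d distinct_indices by (simp add: kdelta_def qa_zero)
  have t: "K_ratio s b c \<otimes>\<^bsub>U\<^esub> K_ratio s c d = K_ratio s b d" using ab index_d(1) by (intro K_ratio_trans)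
  have x: "K_ratio s c d \<otimes>\<^bsub>U\<^esub> E a d \<otimes>\<^bsub>U\<^esub> K_ratio s b c = K_ratio s b d \<otimes>\<^bsub>U\<^esub> E a d"
  proof -
    have "K_ratio s c d \<otimes>\<^bsub>U\<^esub> E a d \<otimes>\<^bsub>U\<^esub> K_ratio s b c = (K_ratio s c d \<otimes>\<^bsub>U\<^esub> K_ratio s b c) \<otimes>\<^bsub>U\<^esub> E a d"
      using ab index_d(1) by (simp add: U.m_assoc e del: atLeastAtMost_iff)
    then show ?thesis using K_ratio_comm[of c d b c] ab index_d(1) by (simp add: t del: atLeastAtMost_iff)
  qed
  have x': "K_ratio s b c \<otimes>\<^bsub>U\<^esub> (K_ratio s c d \<otimes>\<^bsub>U\<^esub> E a d) = K_ratio s b d \<otimes>\<^bsub>U\<^esub> E a d"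
    using ab index_d(1) by (simp add: U.m_assoc[symmetric] t del: atLeastAtMost_iff)
  have y: "E d c \<otimes>\<^bsub>U\<^esub> K_ratio s a d \<otimes>\<^bsub>U\<^esub> E c b = E d c \<otimes>\<^bsub>U\<^esub> E c b \<otimes>\<^bsub>U\<^esub> K_ratio s a d"
    using ab index_d(1) by (simp add: U.m_assoc f del: atLeastAtMost_iff)
  have 1: "pmult (middle s a c d) (pure (K_ratio s b c) (E c b)) \<approx> pure (K_ratio s b d \<otimes>\<^bsub>U\<^esub> E a d) (E d c \<otimes>\<^bsub>U\<^esub> E c b \<otimes>\<^bsub>U\<^esub> K_ratio s a d)"
    unfolding middle_def x[symmetric] y[symmetric]
    by (rule pmult_even[OF _ homog_dc K_ratio_homog]) (use ab index_d(1) in auto)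
  have 2: "pmult (pure (K_ratio s b c) (E c b)) (middle s a c d) \<approx> pure (K_ratio s b d \<otimes>\<^bsub>U\<^esub> E a d) (E c b \<otimes>\<^bsub>U\<^esub> (E d c \<otimes>\<^bsub>U\<^esub> K_ratio s a d))"
    unfolding middle_def x'[symmetric]
    by (rule pmult_even[OF _ E_homog homog_ad _ koszul_middle(2)]) (use ab index_d(1) in auto)
  have z: "E d b \<otimes>\<^bsub>U\<^esub> K_ratio s a d = E d c \<otimes>\<^bsub>U\<^esub> E c b \<otimes>\<^bsub>U\<^esub> K_ratio s a d \<ominus>\<^bsub>U\<^esub> qa m qp c s \<odot>\<^bsub>U\<^esub> (E c b \<otimes>\<^bsub>U\<^esub> (E d c \<otimes>\<^bsub>U\<^esub> K_ratio s a d))"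
    unfolding E_db using ab index_d(1)
    by (simp add: U.minus_eq U.l_distr U.l_minus U.smult_mult_l U.m_assoc del: atLeastAtMost_iff)
  have "middle s a b d \<approx> pure (K_ratio s b d \<otimes>\<^bsub>U\<^esub> E a d) (E d c \<otimes>\<^bsub>U\<^esub> E c b \<otimes>\<^bsub>U\<^esub> K_ratio s a d) -
      scale (qa m qp c s) (pure (K_ratio s b d \<otimes>\<^bsub>U\<^esub> E a d) (E c b \<otimes>\<^bsub>U\<^esub> (E d c \<otimes>\<^bsub>U\<^esub> K_ratio s a d)))"
    unfolding middle_def z by (rule pure_diff_r) (use ab index_d(1) in auto)
  then show ?thesis
    unfolding qcomm_def using cong_diff[OF 1 cong_scale[OF 2]] cong_trans cong_sym by blast
qed

end

text \<open>
  The inductive step: the claimed values satisfy the same recursion as the root vectors.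
\<close>

lemma coprod_E_split: "qcomm (qa m qp c s) (coprod_E s a c) (coprod_E s c b) \<approx> coprod_E s a b"
proof -
  let ?D = "\<lambda>d. qa m qp d 1 - qa m qp d (- 1)"
  let ?q = "qa m qp c s"
  let ?A1 = "pure (E c b) (K_ratio s c b)" and ?A2 = "pure (K_ratio s b c) (E c b)"
  let ?B1 = "pure (E a c) (K_ratio s a c)" and ?B2 = "pure (K_ratio s c a) (E a c)"
  let ?S = "{min a c<..<max a c}"
  \<comment> \<open>Since \<open>c\<close> is adjacent to \<open>b\<close>, the second argument has no middle terms.\<close>
  have "{min c b<..<max c b} = {}" using c by auto
  then have A: "coprod_E s c b = ?A1 + ?A2" by (simp add: coprod_E_def)
  have S: "{min a b<..<max a b} = insert c ?S" "c \<notin> ?S" using c by auto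
  have expand: "qcomm ?q (coprod_E s a c) (coprod_E s c b) =
    ((qcomm ?q ?B1 ?A1 + qcomm ?q ?B1 ?A2) + (qcomm ?q ?B2 ?A1 + qcomm ?q ?B2 ?A2))
    - scale (of_real s) (\<Sum>d\<in>?S. scale (?D d) (qcomm ?q (middle s a c d) ?A1 + qcomm ?q (middle s a c d) ?A2))"
    unfolding A unfolding coprod_E_def qcomm_bilinear
    by (simp only: formal.scale_right_distrib sum.distrib) (simp add: formal.scale_right_distrib)
  have terms: "((qcomm ?q ?B1 ?A1 + qcomm ?q ?B1 ?A2) + (qcomm ?q ?B2 ?A1 + qcomm ?q ?B2 ?A2))
    - scale (of_real s) (\<Sum>d\<in>?S. scale (?D d) (qcomm ?q (middle s a c d) ?A1 + qcomm ?q (middle s a c d) ?A2)) \<approx>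
    ((pure (E a b) (K_ratio s a b) + scale (qa m qp c (- s) - qa m qp c s) (middle s a b c)) + (0 + pure (K_ratio s b a) (E a b)))
    - scale (of_real s) (\<Sum>d\<in>?S. scale (?D d) (0 + middle s a b d))"
    by (intro cong_diff cong_add cong_scale cong_sum qcomm_11 qcomm_12 qcomm_21 qcomm_22 qcomm_middle_1 qcomm_middle_2)
  have collect: "((pure (E a b) (K_ratio s a b) + scale (qa m qp c (- s) - qa m qp c s) (middle s a b c)) + (0 + pure (K_ratio s b a) (E a b)))
    - scale (of_real s) (\<Sum>d\<in>?S. scale (?D d) (0 + middle s a b d)) = coprod_E s a b"
  proof -
    have "scale (qa m qp c (- s) - qa m qp c s) (middle s a b c) = - scale (of_real s) (scale (?D c) (middle s a b c))"
      using s
    proof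
      assume "s = 1" then show ?thesis by (simp add: formal.scale_left_diff_distrib)
    next
      assume "s = - 1" then show ?thesis by (simp add: formal.scale_left_diff_distrib)
    qed
    then show ?thesis
      unfolding coprod_E_def S(1) sum.insert[OF finite_greaterThanLessThan S(2)]
      by (simp only: formal.scale_right_distrib add_0 diff_conv_add_uminus minus_add_distrib ac_simps)
  qed
  show ?thesis unfolding expand using terms unfolding collect .
qed

end

end

lemma coproduct_E:
  assumes cop: "is_coproduct m n P qp \<Delta>" and ab: "a \<in> Ix" "b \<in> Ix" "a \<noteq> b"
  shows "\<Delta> (E a b) = cls (coprod_E (sgn (real a - real b)) a b)"
proof -
  have hom: "\<Delta> \<in> ring_hom U T" and scl: "\<And>c x. x \<in> carrier U \<Longrightarrow> \<Delta> (c \<odot>\<^bsub>U\<^esub> x) = c \<odot>\<^bsub>T\<^esub> \<Delta> x"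
    using cop by (auto simp: is_coproduct_def Let_def superalg_hom_def)
  note simple = cop[unfolded is_coproduct_def Let_def tensor_elt_eq cls_add, THEN conjunct2, THEN conjunct2, rule_format]
  show ?thesis
    using ab
  proof (induction rule: index_pair_induct)
    case (adjacent a b)
    have e: "{i<..<Suc i} = {}" for i by auto
    show ?case
    proof (cases "a = b + 1")
      case True
      then show ?thesis
        using simple[THEN conjunct1, of b] adjacent K_comm[of a b "1 / 2" "- (1 / 2)"]
          K_comm[of b a "1 / 2" "- (1 / 2)"] P_closed
        by (simp add: coprod_E_def K_ratio_def e)
    next
      case False
      then have "b = a + 1" using adjacent by simp
      then show ?thesis
        using simple[THEN conjunct2, of a] adjacent K_comm[of a b "1 / 2" "- (1 / 2)"] P_closed
        by (simp add: coprod_E_def K_ratio_def e)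
    qed
  next
    case (split a c b)
    let ?s = "sgn (real a - real b)"
    have sg: "?s = 1 \<or> ?s = - 1" "sgn (real a - real c) = ?s" "sgn (real c - real b) = ?s"
      using split.hyps(4) by (auto simp: sgn_if)
    note cl = E_closed[OF split.hyps(1,3)] E_closed[OF split.hyps(3,2)]
    note cv = coprod_E_closed[OF sg(1) split.hyps(1,3)] coprod_E_closed[OF sg(1) split.hyps(3,2)]
    \<comment> \<open>Written with a sum, because the homomorphism laws speak of sums and products only.\<close>
    have "\<Delta> (E a b) = \<Delta> (E a c \<otimes>\<^bsub>U\<^esub> E c b \<oplus>\<^bsub>U\<^esub> (- qa m qp c ?s) \<odot>\<^bsub>U\<^esub> (E c b \<otimes>\<^bsub>U\<^esub> E a c))"
      unfolding E_split[OF split.hyps(1,2,4)] using cl by (simp add: U.minus_eq U.smult_neg)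
    also have "\<dots> = cls (qcomm (qa m qp c ?s) (coprod_E ?s a c) (coprod_E ?s c b))"
      using cl cv split.IH unfolding sg(2,3)
      by (simp add: ring_hom_add[OF hom] ring_hom_mult[OF hom] scl cls_qcomm)
    also have "\<dots> = cls (coprod_E ?s a b)"
      unfolding cls_eq_iff by (rule coprod_E_split[OF sg(1) split.hyps(1,2,3,4,5) refl])
    finally show ?case .
  qed
qed

lemma middle_eq:
  assumes s: "s = 1 \<or> s = - 1" and "a \<in> Ix" "b \<in> Ix" "c \<in> Ix"
  shows "pure (K c (- s / 2) \<otimes>\<^bsub>U\<^esub> K b (s / 2) \<otimes>\<^bsub>U\<^esub> E a c) (E c b \<otimes>\<^bsub>U\<^esub> K a (s / 2) \<otimes>\<^bsub>U\<^esub> K c (- s / 2)) = middle s a b c"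
  using assms half_exponents[OF s] K_comm[of c b "- s / 2" "s / 2"]
  by (simp add: middle_def K_ratio_def U.m_assoc del: atLeastAtMost_iff)

lemma cls_coprod_E:
  assumes s: "s = 1 \<or> s = - 1" and ab: "a \<in> Ix" "b \<in> Ix"
  shows "cls (coprod_E s a b) =
    tensor_elt U U (E a b) (K a (s / 2) \<otimes>\<^bsub>U\<^esub> K b (- s / 2)) \<oplus>\<^bsub>T\<^esub>
    tensor_elt U U (K a (- s / 2) \<otimes>\<^bsub>U\<^esub> K b (s / 2)) (E a b) \<ominus>\<^bsub>T\<^esub>
    complex_of_real s \<odot>\<^bsub>T\<^esub>
      (\<Oplus>\<^bsub>T\<^esub>c\<in>{min a b<..<max a b}. (qa m qp c 1 - qa m qp c (- 1)) \<odot>\<^bsub>T\<^esub>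
         tensor_elt U U (K c (- s / 2) \<otimes>\<^bsub>U\<^esub> K b (s / 2) \<otimes>\<^bsub>U\<^esub> E a c)
           (E c b \<otimes>\<^bsub>U\<^esub> K a (s / 2) \<otimes>\<^bsub>U\<^esub> K c (- s / 2)))"
    (is "_ = ?t1 \<oplus>\<^bsub>T\<^esub> ?t2 \<ominus>\<^bsub>T\<^esub> _ \<odot>\<^bsub>T\<^esub> finsum T ?f ?S")
proof -
  interpret T: abelian_group T by (rule T_abelian_group)
  let ?g = "\<lambda>c. scale (qa m qp c 1 - qa m qp c (- 1)) (middle s a b c)"
  have cI: "c \<in> Ix" if "c \<in> ?S" for c using that ab by auto
  have g: "?g c \<in> Pre" if "c \<in> ?S" for c
    unfolding middle_def using cI[OF that] ab s by (intro Pre_closed pure_Pre U.m_closed) auto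
  have f: "?f c = cls (?g c)" if "c \<in> ?S" for c
    unfolding tensor_elt_eq middle_eq[OF s ab cI[OF that]] cls_smult ..
  have "finsum T ?f ?S = finsum T (\<lambda>c. cls (?g c)) ?S"
    by (rule T.finsum_cong') (use f g in auto)
  also have "\<dots> = cls (sum ?g ?S)"
    by (rule cls_finsum) (use g in auto)
  finally have sum: "finsum T ?f ?S = cls (sum ?g ?S)" .
  have k: "K_ratio s b a = K a (- s / 2) \<otimes>\<^bsub>U\<^esub> K b (s / 2)"
    unfolding K_ratio_def using ab half_exponents[OF s] by (intro K_comm)
  have "pure (E a b) (K_ratio s a b) + pure (K_ratio s b a) (E a b) \<in> Pre"
    using ab s by (intro Pre_closed pure_Pre) auto
  moreover have "sum ?g ?S \<in> Pre" using g by (rule Pre_closed)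
  ultimately show ?thesis
    unfolding sum unfolding tensor_elt_eq cls_add cls_smult k[symmetric] K_ratio_def[of s a b, symmetric] coprod_E_def
    by (subst cls_diff) auto
qed

end

theorem lemma3:
  fixes m n a b :: nat
    and q :: complex
    and P :: "real set"
    and qp :: "real \<Rightarrow> complex"
    and \<Delta> :: "(gen list \<Rightarrow>\<^sub>0 complex) set \<Rightarrow>
      ((gen list \<Rightarrow>\<^sub>0 complex) set \<times> (gen list \<Rightarrow>\<^sub>0 complex) set \<Rightarrow>\<^sub>0 complex) set"
  assumes "0 < m" "0 < n"
    and "q \<noteq> 0" "q\<^sup>2 \<noteq> 1"
    and "q_powers q P qp"
    and "is_coproduct m n P qp \<Delta>"
    and "a \<in> {1..m + n}" "b \<in> {1..m + n}"
  shows "let U = Uq m n P qp; T = tensor_superalg U U; t = tensor_elt U U;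
             K = Uq_K m n P qp; E = Uq_E m n P qp;
             S = sgn (real a - real b);
             D = (\<lambda>c. qa m qp c 1 - qa m qp c (- 1))
         in (a = b \<longrightarrow> \<Delta> (K a 1) = t (K a 1) (K a 1)) \<and>
            (a \<noteq> b \<longrightarrow> \<Delta> (E a b) =
               t (E a b) (K a (S / 2) \<otimes>\<^bsub>U\<^esub> K b (- S / 2)) \<oplus>\<^bsub>T\<^esub>
               t (K a (- S / 2) \<otimes>\<^bsub>U\<^esub> K b (S / 2)) (E a b) \<ominus>\<^bsub>T\<^esub>
               complex_of_real S \<odot>\<^bsub>T\<^esub>
                 (\<Oplus>\<^bsub>T\<^esub>c\<in>{min a b<..<max a b}.
                    D c \<odot>\<^bsub>T\<^esub>
                      t (K c (- S / 2) \<otimes>\<^bsub>U\<^esub> K b (S / 2) \<otimes>\<^bsub>U\<^esub> E a c)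
                        (E c b \<otimes>\<^bsub>U\<^esub> K a (S / 2) \<otimes>\<^bsub>U\<^esub> K c (- S / 2))))"
proof -
  interpret quantum_gl m n P q qp
    using assms by unfold_locales
  have K: "\<Delta> (K a 1) = tensor_elt U U (K a 1) (K a 1)"
    using assms(6,7) P_closed by (auto simp: is_coproduct_def Let_def)
  have E: "\<Delta> (E a b) = cls (coprod_E (sgn (real a - real b)) a b)" if "a \<noteq> b"
    using assms(6-8) that by (rule coproduct_E)
  have S: "sgn (real a - real b) = 1 \<or> sgn (real a - real b) = - 1" if "a \<noteq> b"
    using that by (auto simp: sgn_if)
  show ?thesis
    unfolding Let_def
    by (intro conjI impI K) (simp only: E cls_coprod_E[OF S assms(7,8)] not_False_eq_True)
qed

end
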